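(* Let $G$ be the Grigorchuk group (in which case $p=2$) or a Gupta-Sidki $p$-group for a prime $p\geq 3$, acting on the $p$-regular rooted tree $T$. Let $X$ be the orbit under $G$ of some infinite path in $T$. Then for every integer $m\geq 1$ $$o_{p^m}(G,X)\leq (p^5-1)m+1\leq p^5m.$$
   Context: Infinite paths start at the root of $T$ and descend, i.e. are elements of the boundary of $T$. For a group $G$ acting transitively on a set $X$, $o_n(G,X)$ is the maximal number of orbits on $X$ of a subgroup $U$ of index at most $n$ in $G$. For automorphisms $\varphi_1,\dots,\varphi_p$ of $T$, $(\varphi_1,\dots,\varphi_p)$ denotes the automorphism of $T$ fixing level 1 pointwise and acting by $\varphi_i$ on the subtree below the $i$-th vertex of level 1 (identified with $T$). The Grigorchuk group ($p=2$) is $G=\langle a,b,c,d\rangle\leq \mathrm{Aut}(T)$, where $a$ interchanges the two subtrees at level 1, and $b=(a,c)$, $c=(a,d)$, $d=(1,b)$. The Gupta-Sidki $p$-group ($p\ge 3$) is $G=\langle a,b\rangle\leq\mathrm{Aut}(T)$, where $a$ cyclically permutes the $p$ subtrees at level 1, and $b=(a,a^{-1},1,\dots,1,b)$. *)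

theory Defs
  imports
    Complex_Main
    "HOL-Library.Extended_Nat"
    "HOL-Computational_Algebra.Primes"
    "HOL-Algebra.Group_Action"
    "HOL-Algebra.Generated_Groups"
begin

section \<open>The \<open>p\<close>-regular rooted tree and its automorphisms\<close>

text \<open>Vertices are the finite words over \<open>{0, \<dots>, p - 1}\<close>; the root is the empty word, and the
  children of \<open>u\<close> are the words \<open>u @ [i]\<close>. The level-1 vertices are thus numbered from 0.\<close>

definition tree_vertices :: "nat \<Rightarrow> nat list set" where
  "tree_vertices p = lists {..<p}"

definition is_child :: "nat list \<Rightarrow> nat list \<Rightarrow> bool" where
  "is_child u v \<longleftrightarrow> (\<exists>i. v = u @ [i])"

definition tree_auts :: "nat \<Rightarrow> (nat list \<Rightarrow> nat list) set" where
  "tree_auts p = {f \<in> Bij (tree_vertices p). f [] = [] \<and>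
     (\<forall>u \<in> tree_vertices p. \<forall>v \<in> tree_vertices p. is_child (f u) (f v) \<longleftrightarrow> is_child u v)}"

definition tree_Aut :: "nat \<Rightarrow> (nat list \<Rightarrow> nat list) monoid" where
  "tree_Aut p = BijGroup (tree_vertices p) \<lparr>carrier := tree_auts p\<rparr>"

text \<open>The automorphism \<open>(\<phi>\<^sub>1, \<dots>, \<phi>\<^sub>p)\<close>, given as a list of length \<open>p\<close>.\<close>

definition tuple_aut :: "(nat list \<Rightarrow> nat list) list \<Rightarrow> nat list \<Rightarrow> nat list" where
  "tuple_aut \<phi>s = (\<lambda>w \<in> tree_vertices (length \<phi>s). case w of [] \<Rightarrow> [] | i # v \<Rightarrow> i # (\<phi>s ! i) v)"

definition rotation :: "nat \<Rightarrow> nat list \<Rightarrow> nat list" where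
  "rotation p = (\<lambda>w \<in> tree_vertices p. case w of [] \<Rightarrow> [] | i # v \<Rightarrow> ((i + 1) mod p) # v)"


section \<open>The two families of groups\<close>

text \<open>The recursive generators are defined by recursion on words. That they are tree automorphisms
  and satisfy the wreath recursions is shown in the lemmas \<open>grig_recursion\<close> and
  \<open>gs_recursion\<close> below.\<close>

definition grig_a :: "nat list \<Rightarrow> nat list" where
  "grig_a = rotation 2"

fun grig_b_word grig_c_word grig_d_word :: "nat list \<Rightarrow> nat list" where
  "grig_b_word [] = []"
| "grig_b_word (i # v) = i # (if i = 0 then grig_a v else grig_c_word v)"
| "grig_c_word [] = []"
| "grig_c_word (i # v) = i # (if i = 0 then grig_a v else grig_d_word v)"
| "grig_d_word [] = []"
| "grig_d_word (i # v) = i # (if i = 0 then v else grig_b_word v)"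

definition grig_b :: "nat list \<Rightarrow> nat list" where
  "grig_b = restrict grig_b_word (tree_vertices 2)"

definition grig_c :: "nat list \<Rightarrow> nat list" where
  "grig_c = restrict grig_c_word (tree_vertices 2)"

definition grig_d :: "nat list \<Rightarrow> nat list" where
  "grig_d = restrict grig_d_word (tree_vertices 2)"

definition grigorchuk_group :: "(nat list \<Rightarrow> nat list) monoid" where
  "grigorchuk_group =
     tree_Aut 2 \<lparr>carrier := generate (tree_Aut 2) {grig_a, grig_b, grig_c, grig_d}\<rparr>"

text \<open>Replacing the rotation by its inverse replaces the directed generator by its inverse as well,
  so the group does not depend on the sense in which the generator \<open>a\<close> rotates the subtrees.\<close>

definition gs_a :: "nat \<Rightarrow> nat list \<Rightarrow> nat list" where
  "gs_a p = rotation p"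

fun gs_b_word :: "nat \<Rightarrow> nat list \<Rightarrow> nat list" where
  "gs_b_word p [] = []"
| "gs_b_word p (i # v) = i #
     (if i = 0 then gs_a p v
      else if i = 1 then (inv\<^bsub>tree_Aut p\<^esub> (gs_a p)) v
      else if i = p - 1 then gs_b_word p v
      else v)"

definition gs_b :: "nat \<Rightarrow> nat list \<Rightarrow> nat list" where
  "gs_b p = restrict (gs_b_word p) (tree_vertices p)"

definition gupta_sidki_group :: "nat \<Rightarrow> (nat list \<Rightarrow> nat list) monoid" where
  "gupta_sidki_group p = tree_Aut p \<lparr>carrier := generate (tree_Aut p) {gs_a p, gs_b p}\<rparr>"


section \<open>The boundary of the tree\<close>

definition tree_boundary :: "nat \<Rightarrow> (nat \<Rightarrow> nat list) set" where
  "tree_boundary p =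
     {\<xi>. \<xi> 0 = [] \<and> (\<forall>n. \<xi> n \<in> tree_vertices p \<and> is_child (\<xi> n) (\<xi> (Suc n)))}"

text \<open>The action on a set \<open>E\<close> of infinite paths; it is made extensional, as actions in the sense
  of \<^locale>\<open>group_action\<close> are.\<close>

definition path_action ::
    "(nat \<Rightarrow> nat list) set \<Rightarrow> (nat list \<Rightarrow> nat list) \<Rightarrow> (nat \<Rightarrow> nat list) \<Rightarrow> (nat \<Rightarrow> nat list)" where
  "path_action E g = (\<lambda>\<xi> \<in> E. \<lambda>n. g (\<xi> n))"


section \<open>The maximal number of orbits of a subgroup of bounded index\<close>

definition ecard :: "'a set \<Rightarrow> enat" where
  "ecard A = (if finite A then enat (card A) else \<infinity>)"

text \<open>Infinite index has to be excluded explicitly, as \<^const>\<open>card\<close> is 0 on infinite sets. For a transitive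
  action the number of orbits of a subgroup is at most its index, so the supremum is a maximum when
  \<open>n \<ge> 1\<close>.\<close>

definition max_orbits ::
    "nat \<Rightarrow> ('g, 'c) monoid_scheme \<Rightarrow> 'x set \<Rightarrow> ('g \<Rightarrow> 'x \<Rightarrow> 'x) \<Rightarrow> enat" where
  "max_orbits n G X \<phi> =
     (SUP U \<in> {U. subgroup U G \<and> finite (rcosets\<^bsub>G\<^esub> U) \<and> card (rcosets\<^bsub>G\<^esub> U) \<le> n}.
        ecard (orbits (G \<lparr>carrier := U\<rparr>) X \<phi>))"


section \<open>Well-definedness\<close>

lemma Nil_in_tree_vertices [simp]: "[] \<in> tree_vertices p"
  by (simp add: tree_vertices_def)

lemma Cons_in_tree_vertices [simp]:
  "i # v \<in> tree_vertices p \<longleftrightarrow> i < p \<and> v \<in> tree_vertices p"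
  by (auto simp: tree_vertices_def)

lemma snoc_in_tree_vertices [simp]:
  "v @ [i] \<in> tree_vertices p \<longleftrightarrow> i < p \<and> v \<in> tree_vertices p"
  by (auto simp: tree_vertices_def)

lemma subgroup_tree_auts: "subgroup (tree_auts p) (BijGroup (tree_vertices p))"
proof (rule group.subgroupI[OF group_BijGroup])
  let ?V = "tree_vertices p"
  show "tree_auts p \<subseteq> carrier (BijGroup ?V)"
    by (auto simp: tree_auts_def BijGroup_def)
  have "(\<lambda>x\<in>?V. x) \<in> tree_auts p"
    by (auto simp: tree_auts_def id_Bij)
  then show "tree_auts p \<noteq> {}" by blast
next
  let ?V = "tree_vertices p"
  fix f assume f: "f \<in> tree_auts p"
  then have fB: "f \<in> Bij ?V" by (simp add: tree_auts_def)
  then have bij: "bij_betw f ?V ?V" by (simp add: Bij_def)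
  let ?g = "inv_into ?V f"
  have g: "?g u \<in> ?V" "f (?g u) = u" if "u \<in> ?V" for u
    using bij that by (auto simp: bij_betw_def inv_into_into f_inv_into_f)
  have "?g [] = []"
    using f bij by (metis (mono_tags, lifting) Nil_in_tree_vertices bij_betw_inv_into_left
        mem_Collect_eq tree_auts_def)
  moreover have "is_child (?g u) (?g v) \<longleftrightarrow> is_child u v" if "u \<in> ?V" "v \<in> ?V" for u v
    proof -
    have "is_child (f (?g u)) (f (?g v)) \<longleftrightarrow> is_child (?g u) (?g v)"
      using f g(1)[OF that(1)] g(1)[OF that(2)] by (simp add: tree_auts_def)
    then show ?thesis by (simp only: g(2)[OF that(1)] g(2)[OF that(2)])
  qed
  ultimately show "inv\<^bsub>BijGroup ?V\<^esub> f \<in> tree_auts p"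
    unfolding inv_BijGroup[OF fB]
    using restrict_inv_into_Bij[OF fB] by (simp add: tree_auts_def)
next
  let ?V = "tree_vertices p"
  fix f g assume f: "f \<in> tree_auts p" and g: "g \<in> tree_auts p"
  have gV: "g u \<in> ?V" if "u \<in> ?V" for u
    using g that Bij_imp_funcset by (fastforce simp: tree_auts_def)
  have "compose ?V f g \<in> Bij ?V"
    using f g by (auto simp: tree_auts_def intro: compose_Bij)
  then have "compose ?V f g \<in> tree_auts p"
    using f g gV by (auto simp: tree_auts_def compose_def)
  then show "f \<otimes>\<^bsub>BijGroup ?V\<^esub> g \<in> tree_auts p"
    using f g by (simp add: BijGroup_def tree_auts_def)
qed

lemma group_tree_Aut: "group (tree_Aut p)"
  unfolding tree_Aut_def
  by (rule group.subgroup_imp_group[OF group_BijGroup subgroup_tree_auts])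

lemma carrier_tree_Aut: "carrier (tree_Aut p) = tree_auts p"
  by (simp add: tree_Aut_def)

lemma one_tree_Aut: "\<one>\<^bsub>tree_Aut p\<^esub> = (\<lambda>x \<in> tree_vertices p. x)"
  by (simp add: tree_Aut_def BijGroup_def)

lemma mult_tree_Aut:
  "f \<in> tree_auts p \<Longrightarrow> g \<in> tree_auts p \<Longrightarrow> f \<otimes>\<^bsub>tree_Aut p\<^esub> g = compose (tree_vertices p) f g"
  by (simp add: tree_Aut_def BijGroup_def tree_auts_def)

lemma tree_auts_closed: "f \<in> tree_auts p \<Longrightarrow> u \<in> tree_vertices p \<Longrightarrow> f u \<in> tree_vertices p"
  using Bij_imp_funcset by (fastforce simp: tree_auts_def)

lemma tree_auts_Nil: "f \<in> tree_auts p \<Longrightarrow> f [] = []"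
  by (simp add: tree_auts_def)

lemma tree_auts_inj: "f \<in> tree_auts p \<Longrightarrow> inj_on f (tree_vertices p)"
  by (simp add: tree_auts_def Bij_def bij_betw_def)

lemma tree_auts_snoc:
  assumes "f \<in> tree_auts p" "u @ [i] \<in> tree_vertices p"
  shows "\<exists>j. f (u @ [i]) = f u @ [j]"
proof -
  have "is_child (f u) (f (u @ [i])) \<longleftrightarrow> is_child u (u @ [i])"
    using assms unfolding tree_auts_def by simp
  then show ?thesis by (simp add: is_child_def)
qed

lemma tree_autsI:
  assumes ext: "f \<in> extensional (tree_vertices p)"
    and nil: "f [] = []"
    and closed: "\<And>u. u \<in> tree_vertices p \<Longrightarrow> f u \<in> tree_vertices p"
    and inj: "inj_on f (tree_vertices p)"
    and snoc: "\<And>u i. u @ [i] \<in> tree_vertices p \<Longrightarrow> \<exists>j. f (u @ [i]) = f u @ [j]"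
  shows "f \<in> tree_auts p"
proof -
  let ?V = "tree_vertices p"
  have len: "length (f u) = length u" if "u \<in> ?V" for u
    using that
  proof (induction u rule: rev_induct)
    case (snoc x xs)
    then show ?case using assms(5)[of xs x] by auto
  qed (simp add: nil)
  have "w \<in> f ` ?V" if w: "w \<in> ?V" for w
  proof -
    let ?L = "{u \<in> ?V. length u = length w}"
    have "finite ?L"
      using finite_lists_length_eq[of "{..<p}" "length w"]
      by (simp add: tree_vertices_def lists_eq_set conj_commute)
    moreover have "f ` ?L \<subseteq> ?L" using closed len by auto
    moreover have "inj_on f ?L" using inj by (rule inj_on_subset) auto
    ultimately have "f ` ?L = ?L" by (rule endo_inj_surj)
    with w show ?thesis by blast
  qed
  then have "f \<in> Bij ?V"
    using ext inj closed by (auto simp: Bij_def bij_betw_def)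
  moreover have "is_child (f u) (f v) \<longleftrightarrow> is_child u v" if u: "u \<in> ?V" and v: "v \<in> ?V" for u v
  proof
    assume "is_child (f u) (f v)"
    then obtain i where i: "f v = f u @ [i]" by (auto simp: is_child_def)
    then have "v \<noteq> []" using nil by auto
    then obtain v' j where vj: "v = v' @ [j]" by (metis rev_exhaust)
    with v have v': "v' \<in> ?V" by simp
    have "f v' = f u" using snoc v vj i by fastforce
    then have "v' = u" using inj u v' by (auto dest: inj_onD)
    then show "is_child u v" using vj by (simp add: is_child_def)
  next
    assume "is_child u v"
    then show "is_child (f u) (f v)" using snoc v by (auto simp: is_child_def)
  qed
  ultimately show ?thesis using nil by (simp add: tree_auts_def)
qed

lemma rotation_in_tree_auts:
  assumes "p > 0"
  shows "rotation p \<in> tree_auts p"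
proof (rule tree_autsI)
  show "rotation p \<in> extensional (tree_vertices p)" by (simp add: rotation_def)
  show "rotation p [] = []" by (simp add: rotation_def)
  show "rotation p u \<in> tree_vertices p" if "u \<in> tree_vertices p" for u
    using that assms by (cases u) (auto simp: rotation_def)
  have mod_inj: "i = j" if "Suc i mod p = Suc j mod p" "i < p" "j < p" for i j
    using that by (simp add: mod_Suc split: if_splits)
  show "inj_on (rotation p) (tree_vertices p)"
  proof (rule inj_onI)
    fix x y
    assume "x \<in> tree_vertices p" "y \<in> tree_vertices p" "rotation p x = rotation p y"
    then show "x = y" by (cases x; cases y) (auto simp: rotation_def dest: mod_inj)
  qed
  show "\<exists>j. rotation p (u @ [i]) = rotation p u @ [j]" if "u @ [i] \<in> tree_vertices p" for u i
    using that by (cases u) (auto simp: rotation_def)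
qed

text \<open>A word function that keeps the first letter and continues with a tree automorphism or with
  a word function of the same kind is a tree automorphism.\<close>

lemma word_recursion_in_tree_auts:
  fixes F :: "'k \<Rightarrow> nat list \<Rightarrow> nat list"
  assumes nil: "\<And>k. F k [] = []"
    and cons: "\<And>k i. i < p \<Longrightarrow>
      \<exists>\<psi>. (\<psi> \<in> tree_auts p \<or> \<psi> \<in> range F) \<and>
        (\<forall>v \<in> tree_vertices p. F k (i # v) = i # \<psi> v)"
  shows "restrict (F k) (tree_vertices p) \<in> tree_auts p"
proof -
  let ?V = "tree_vertices p"
  have closed: "\<forall>k. F k u \<in> ?V" if "u \<in> ?V" for u
    using that
  proof (induction u)
    case (Cons i v)
    then have iv: "i < p" "v \<in> ?V" by auto
    show ?case
    proof
      fix k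
      obtain \<psi> where "\<psi> \<in> tree_auts p \<or> \<psi> \<in> range F" "F k (i # v) = i # \<psi> v"
        using cons[OF iv(1), of k] iv by blast
      then show "F k (i # v) \<in> ?V" using iv Cons.IH tree_auts_closed by auto
    qed
  qed (simp add: nil)
  have inj: "\<forall>k y. y \<in> ?V \<longrightarrow> F k x = F k y \<longrightarrow> x = y" if "x \<in> ?V" for x
    using that
  proof (induction x)
    case Nil
    show ?case
    proof (intro allI impI)
      fix k y assume "y \<in> ?V" "F k [] = F k y"
      then show "[] = y" using nil cons[of "hd y" k] by (cases y) auto
    qed
  next
    case (Cons i v)
    then have iv: "i < p" "v \<in> ?V" by auto
    show ?case
    proof (intro allI impI)
      fix k y assume y: "y \<in> ?V" and eq: "F k (i # v) = F k y"
      obtain \<psi> where \<psi>: "\<psi> \<in> tree_auts p \<or> \<psi> \<in> range F"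
        "\<And>v. v \<in> ?V \<Longrightarrow> F k (i # v) = i # \<psi> v"
        using cons[OF iv(1), of k] by blast
      have "y \<noteq> []" using eq \<psi>(2) iv nil[of k] by auto
      then obtain j w where jw: "y = j # w" by (cases y) auto
      with y have w: "j < p" "w \<in> ?V" by auto
      have "j = i" using eq \<psi>(2) iv w jw cons[OF w(1), of k] by auto
      then have "\<psi> v = \<psi> w" using eq \<psi>(2) iv w jw by auto
      moreover have "\<psi> v = \<psi> w \<longrightarrow> v = w"
        using \<psi>(1) iv w Cons.IH by (auto dest: inj_onD[OF tree_auts_inj])
      ultimately show "i # v = y" using jw \<open>j = i\<close> by simp
    qed
  qed
  have snoc: "\<forall>k. \<exists>j. F k (u @ [i]) = F k u @ [j]" if "u @ [i] \<in> ?V" for u i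
    using that
  proof (induction u)
    case Nil
    show ?case
    proof
      fix k
      obtain \<psi> where "\<psi> \<in> tree_auts p \<or> \<psi> \<in> range F" "F k [i] = i # \<psi> []"
        using cons[of i k] Nil Nil_in_tree_vertices[of p] by (metis snoc_in_tree_vertices)
      then show "\<exists>j. F k ([] @ [i]) = F k [] @ [j]" using nil by (auto simp: tree_auts_Nil)
    qed
  next
    case (Cons h v)
    then have iv: "h < p" "v @ [i] \<in> ?V" by auto
    then have v: "v \<in> ?V" by simp
    show ?case
    proof
      fix k
      obtain \<psi> where \<psi>: "\<psi> \<in> tree_auts p \<or> \<psi> \<in> range F"
        "F k (h # v @ [i]) = h # \<psi> (v @ [i])" "F k (h # v) = h # \<psi> v"
        using cons[OF iv(1), of k] iv(2) v by blast
      have "\<exists>j. \<psi> (v @ [i]) = \<psi> v @ [j]"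
        using \<psi>(1) Cons.IH iv(2) tree_auts_snoc by auto
      then show "\<exists>j. F k ((h # v) @ [i]) = F k (h # v) @ [j]" using \<psi> by auto
    qed
  qed
  show ?thesis
  proof (rule tree_autsI)
    show "inj_on (restrict (F k) ?V) ?V" using inj by (auto simp: inj_on_def)
    show "\<exists>j. restrict (F k) ?V (u @ [i]) = restrict (F k) ?V u @ [j]"
      if "u @ [i] \<in> ?V" for u i
      using snoc[OF that] that by simp
  qed (use nil closed in auto)
qed

lemma id_in_tree_auts: "(\<lambda>x \<in> tree_vertices p. x) \<in> tree_auts p"
  using group.is_monoid[OF group_tree_Aut] monoid.one_closed
  by (metis carrier_tree_Aut one_tree_Aut)

lemma grig_in_tree_auts:
  "grig_a \<in> tree_auts 2" "grig_b \<in> tree_auts 2" "grig_c \<in> tree_auts 2" "grig_d \<in> tree_auts 2"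
proof -
  let ?F = "\<lambda>k::nat. if k = 0 then grig_b_word else if k = 1 then grig_c_word else grig_d_word"
  show a: "grig_a \<in> tree_auts 2" by (simp add: grig_a_def rotation_in_tree_auts)
  have r: "grig_b_word \<in> range ?F" "grig_c_word \<in> range ?F" "grig_d_word \<in> range ?F"
    by (auto intro: rev_image_eqI[of 0] rev_image_eqI[of 1] rev_image_eqI[of 2])
  have "restrict (?F k) (tree_vertices 2) \<in> tree_auts 2" for k
  proof (rule word_recursion_in_tree_auts[where F = ?F and k = k])
    show "\<exists>\<psi>. (\<psi> \<in> tree_auts 2 \<or> \<psi> \<in> range ?F) \<and>
            (\<forall>v\<in>tree_vertices 2. ?F k (i # v) = i # \<psi> v)" for k :: nat and i
    proof -
      let ?\<psi> = "if i = 0 then (if k = 0 \<or> k = 1 then grig_a else (\<lambda>x\<in>tree_vertices 2. x))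
        else (if k = 0 then grig_c_word else if k = 1 then grig_d_word else grig_b_word)"
      have "?\<psi> \<in> tree_auts 2 \<or> ?\<psi> \<in> range ?F"
        using a r id_in_tree_auts by presburger
      moreover have "\<forall>v\<in>tree_vertices 2. ?F k (i # v) = i # ?\<psi> v" by simp
      ultimately show ?thesis by blast
    qed
  qed simp_all
  from this[of 0] this[of 1] this[of 2]
  show "grig_b \<in> tree_auts 2" "grig_c \<in> tree_auts 2" "grig_d \<in> tree_auts 2"
    by (simp_all add: grig_b_def grig_c_def grig_d_def)
qed

lemma grig_recursion:
  "grig_b = tuple_aut [grig_a, grig_c]"
  "grig_c = tuple_aut [grig_a, grig_d]"
  "grig_d = tuple_aut [\<one>\<^bsub>tree_Aut 2\<^esub>, grig_b]"
proof -
  have "grig_b w = tuple_aut [grig_a, grig_c] w \<and> grig_c w = tuple_aut [grig_a, grig_d] w \<and>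
    grig_d w = tuple_aut [\<one>\<^bsub>tree_Aut 2\<^esub>, grig_b] w" for w
  proof (cases w)
    case Nil
    show ?thesis unfolding Nil
      by (simp add: grig_b_def grig_c_def grig_d_def tuple_aut_def)
  next
    case (Cons i v)
    have "i < 2 \<Longrightarrow> i = 0 \<or> i = 1" by linarith
    then show ?thesis
      unfolding Cons numeral_2_eq_2
      by (cases "i # v \<in> tree_vertices (Suc (Suc 0))")
        (auto simp: grig_b_def grig_c_def grig_d_def tuple_aut_def one_tree_Aut
          numeral_2_eq_2 less_Suc_eq)
  qed
  note * = this
  show "grig_b = tuple_aut [grig_a, grig_c]" by (rule ext) (rule conjunct1[OF *])
  show "grig_c = tuple_aut [grig_a, grig_d]" by (rule ext) (rule conjunct1[OF conjunct2[OF *]])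
  show "grig_d = tuple_aut [\<one>\<^bsub>tree_Aut 2\<^esub>, grig_b]"
    by (rule ext) (rule conjunct2[OF conjunct2[OF *]])
qed

lemma gs_in_tree_auts:
  assumes "p > 0"
  shows "gs_a p \<in> tree_auts p" "gs_b p \<in> tree_auts p"
proof -
  show a: "gs_a p \<in> tree_auts p" using assms by (simp add: gs_a_def rotation_in_tree_auts)
  then have a': "inv\<^bsub>tree_Aut p\<^esub> (gs_a p) \<in> tree_auts p"
    using group.inv_closed[OF group_tree_Aut] by (simp add: carrier_tree_Aut)
  let ?F = "\<lambda>k::unit. gs_b_word p"
  have "restrict (?F ()) (tree_vertices p) \<in> tree_auts p"
  proof (rule word_recursion_in_tree_auts[where F = ?F])
    show "\<exists>\<psi>. (\<psi> \<in> tree_auts p \<or> \<psi> \<in> range ?F) \<and>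
            (\<forall>v\<in>tree_vertices p. ?F k (i # v) = i # \<psi> v)" for k :: unit and i
    proof -
      let ?\<psi> = "if i = 0 then gs_a p else if i = 1 then inv\<^bsub>tree_Aut p\<^esub> (gs_a p)
        else if i = p - 1 then gs_b_word p else (\<lambda>x\<in>tree_vertices p. x)"
      have "?\<psi> \<in> tree_auts p \<or> ?\<psi> \<in> range ?F"
        using a a' id_in_tree_auts by auto
      moreover have "\<forall>v\<in>tree_vertices p. ?F k (i # v) = i # ?\<psi> v" by simp
      ultimately show ?thesis by blast
    qed
  qed simp
  then show "gs_b p \<in> tree_auts p" by (simp add: gs_b_def)
qed

lemma gs_recursion:
  assumes "p \<ge> 3"
  shows "gs_b p = tuple_aut ([gs_a p, inv\<^bsub>tree_Aut p\<^esub> (gs_a p)] @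
           replicate (p - 3) \<one>\<^bsub>tree_Aut p\<^esub> @ [gs_b p])" (is "_ = tuple_aut ?l")
proof
  fix w
  have len: "length ?l = p" using assms by simp
  have nth: "?l ! i = (if i = 0 then gs_a p else if i = 1 then inv\<^bsub>tree_Aut p\<^esub> (gs_a p)
      else if i = p - 1 then gs_b p else \<one>\<^bsub>tree_Aut p\<^esub>)" if "i < p" for i
    using that assms by (auto simp: nth_append nth_Cons' )
  show "gs_b p w = tuple_aut ?l w"
  proof (cases "w \<in> tree_vertices p")
    case False
    then show ?thesis unfolding tuple_aut_def len by (simp add: gs_b_def)
  next
    case True
    show ?thesis
    proof (cases w)
      case Nil
      then show ?thesis unfolding tuple_aut_def len by (simp add: gs_b_def)
    next
      case (Cons i v)
      with True have "i < p" "v \<in> tree_vertices p" by auto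
      moreover from this have "tuple_aut ?l w = i # (?l ! i) v"
        unfolding tuple_aut_def len Cons by simp
      ultimately show ?thesis
        by (simp only: nth) (simp add: Cons one_tree_Aut gs_b_def)
    qed
  qed
qed

lemma grigorchuk_group_subgroup: "subgroup (carrier grigorchuk_group) (tree_Aut 2)"
  using group.generate_is_subgroup[OF group_tree_Aut] grig_in_tree_auts
  by (simp add: grigorchuk_group_def carrier_tree_Aut)

lemma gupta_sidki_group_subgroup:
  "p > 0 \<Longrightarrow> subgroup (carrier (gupta_sidki_group p)) (tree_Aut p)"
  using group.generate_is_subgroup[OF group_tree_Aut] gs_in_tree_auts
  by (simp add: gupta_sidki_group_def carrier_tree_Aut)

lemma path_action_closed:
  assumes "g \<in> tree_auts p" "\<xi> \<in> tree_boundary p"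
  shows "path_action (tree_boundary p) g \<xi> \<in> tree_boundary p"
  using assms tree_auts_closed[OF assms(1)]
  by (auto simp: path_action_def tree_boundary_def tree_auts_def)

text \<open>A subgroup of the automorphism group of the tree acts transitively on each of its orbits
  in the boundary.\<close>

lemma transitive_action_orbit:
  assumes H: "subgroup H (tree_Aut p)" and \<xi>: "\<xi> \<in> tree_boundary p"
  defines "G \<equiv> tree_Aut p \<lparr>carrier := H\<rparr>"
  defines "X \<equiv> orbit G (path_action (tree_boundary p)) \<xi>"
  shows "transitive_action G X (path_action X)"
proof -
  let ?V = "tree_vertices p"
  interpret G: group G
    unfolding G_def by (rule group.subgroup_imp_group[OF group_tree_Aut H])
  have HA: "h \<in> tree_auts p" if "h \<in> H" for h
    using subgroup.mem_carrier[OF H that] by (simp add: carrier_tree_Aut)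
  have mult: "h \<otimes>\<^bsub>G\<^esub> k = compose ?V h k" if "h \<in> H" "k \<in> H" for h k
    using mult_tree_Aut HA that by (simp add: G_def)
  have carr: "carrier G = H" by (simp add: G_def)
  have one: "\<one>\<^bsub>G\<^esub> = (\<lambda>x\<in>?V. x)" by (simp add: G_def one_tree_Aut)
  have X_iff: "\<eta> \<in> X \<longleftrightarrow> (\<exists>g \<in> H. \<eta> = (\<lambda>n. g (\<xi> n)))" for \<eta>
    unfolding X_def orbit_def carr using \<xi> by (auto simp: path_action_def)
  have XV: "\<eta> n \<in> ?V" if "\<eta> \<in> X" for \<eta> n
    using that \<xi> HA tree_auts_closed by (auto simp: X_iff tree_boundary_def)
  have comp: "(\<lambda>n. (h \<otimes>\<^bsub>G\<^esub> k) (\<eta> n)) = (\<lambda>n. h (k (\<eta> n)))"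
    if "h \<in> H" "k \<in> H" "\<And>n. \<eta> n \<in> ?V" for h k \<eta>
    using that by (simp add: mult compose_def)
  have \<xi>V: "\<xi> n \<in> ?V" for n using \<xi> by (simp add: tree_boundary_def)
  have closed: "(\<lambda>n. h (\<eta> n)) \<in> X" if h: "h \<in> H" and \<eta>: "\<eta> \<in> X" for h \<eta>
  proof -
    obtain g where g: "g \<in> H" "\<eta> = (\<lambda>n. g (\<xi> n))" using \<eta> X_iff by blast
    have "h \<otimes>\<^bsub>G\<^esub> g \<in> H" using G.m_closed carr g h by metis
    then show ?thesis using comp[OF h g(1), of \<xi>] \<xi>V g(2) X_iff by metis
  qed
  have inv: "(\<lambda>n. h ((inv\<^bsub>G\<^esub> h) (\<eta> n))) = \<eta>" "(\<lambda>n. (inv\<^bsub>G\<^esub> h) (h (\<eta> n))) = \<eta>"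
    if h: "h \<in> H" and \<eta>: "\<eta> \<in> X" for h \<eta>
  proof -
    have i: "inv\<^bsub>G\<^esub> h \<in> H" using G.inv_closed carr h by metis
    have e: "h \<otimes>\<^bsub>G\<^esub> inv\<^bsub>G\<^esub> h = \<one>\<^bsub>G\<^esub>" "inv\<^bsub>G\<^esub> h \<otimes>\<^bsub>G\<^esub> h = \<one>\<^bsub>G\<^esub>" using carr h by auto
    show "(\<lambda>n. h ((inv\<^bsub>G\<^esub> h) (\<eta> n))) = \<eta>"
      using comp[OF h i, of \<eta>] XV[OF \<eta>] by (simp add: e one)
    show "(\<lambda>n. (inv\<^bsub>G\<^esub> h) (h (\<eta> n))) = \<eta>"
      using comp[OF i h, of \<eta>] XV[OF \<eta>] by (simp add: e one)
  qed
  have bij: "path_action X h \<in> Bij X" if h: "h \<in> H" for h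
  proof -
    have i: "inv\<^bsub>G\<^esub> h \<in> H" using G.inv_closed carr h by metis
    have "bij_betw (path_action X h) X X"
      by (rule bij_betw_byWitness[where f' = "path_action X (inv\<^bsub>G\<^esub> h)"])
        (use closed h i inv in \<open>auto simp: path_action_def\<close>)
    then show ?thesis by (simp add: Bij_def path_action_def)
  qed
  have hom: "path_action X (h \<otimes>\<^bsub>G\<^esub> k) = compose X (path_action X h) (path_action X k)"
    if h: "h \<in> H" and k: "k \<in> H" for h k
  proof
    fix \<eta>
    show "path_action X (h \<otimes>\<^bsub>G\<^esub> k) \<eta> = compose X (path_action X h) (path_action X k) \<eta>"
      using comp[OF h k, of \<eta>] XV[of \<eta>] closed[OF k, of \<eta>]
      by (simp add: path_action_def compose_def restrict_def)
  qed
  have act: "group_action G X (path_action X)"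
    unfolding group_action_def group_hom_def group_hom_axioms_def
  proof (intro conjI G.is_group group_BijGroup homI)
    show "path_action X h \<in> carrier (BijGroup X)" if "h \<in> carrier G" for h
      using bij that by (simp add: carr BijGroup_def)
    show "path_action X (h \<otimes>\<^bsub>G\<^esub> k) = path_action X h \<otimes>\<^bsub>BijGroup X\<^esub> path_action X k"
      if "h \<in> carrier G" "k \<in> carrier G" for h k
      using hom bij that by (simp add: carr BijGroup_def)
  qed
  show ?thesis
    unfolding transitive_action_def transitive_action_axioms_def carr
  proof (intro conjI act allI impI)
    fix \<eta> \<zeta> assume \<eta>: "\<eta> \<in> X" and \<zeta>: "\<zeta> \<in> X"
    obtain g h where g: "g \<in> H" "\<eta> = (\<lambda>n. g (\<xi> n))" and h: "h \<in> H" "\<zeta> = (\<lambda>n. h (\<xi> n))"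
      using \<eta> \<zeta> X_iff by blast
    have i: "inv\<^bsub>G\<^esub> g \<in> H" using G.inv_closed carr g by metis
    have gi: "inv\<^bsub>G\<^esub> g \<otimes>\<^bsub>G\<^esub> g = \<one>\<^bsub>G\<^esub>" using carr g by auto
    have \<xi>: "(\<lambda>n. (inv\<^bsub>G\<^esub> g) (\<eta> n)) = \<xi>"
      using comp[OF i g(1), of \<xi>] \<xi>V by (simp add: gi one g(2))
    have "h \<otimes>\<^bsub>G\<^esub> inv\<^bsub>G\<^esub> g \<in> H" using G.m_closed carr i h by metis
    moreover have "path_action X (h \<otimes>\<^bsub>G\<^esub> inv\<^bsub>G\<^esub> g) \<eta> = \<zeta>"
      using \<eta> comp[OF h(1) i, of \<eta>] XV[OF \<eta>] \<xi> h(2)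
      by (auto simp: path_action_def fun_eq_iff)
    ultimately show "\<exists>k\<in>H. path_action X k \<eta> = \<zeta>" by blast
  qed
qed

end

theory Submission
  imports Defs
begin

text \<open>
  An automorphism of the tree is determined by its permutation of level 1 and its \<open>p\<close> sections, the
  automorphisms that it induces below the vertices of level 1. For a subgroup \<open>U\<close> of \<open>G\<close> let
  \<open>U\<^sub>i\<close> be the group of sections at \<open>i\<close> of the elements of \<open>U\<close> that fix \<open>i\<close>. The number of orbits
  \<open>o(U)\<close> on \<open>X\<close> is at most the sum of the \<open>o(U\<^sub>i)\<close>, and at most a single \<open>o(U\<^sub>i)\<close> if \<open>U\<close> is transitive on
  level 1 (\<open>orbits_le_sum\<close>, \<open>orbits_le_transitive\<close>). So the orbits multiply only where transitivity
  fails, and the point is that each such failure costs a factor in the index.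

  To measure this, let \<open>N\<close> be the normal closure of \<open>[a, b]\<close>. In both families \<open>G\<close> branches over \<open>N\<close>: the
  product \<open>N \<times> \<dots> \<times> N\<close> of \<open>p\<close> copies acting on the subtrees is contained in \<open>N\<close>. Put
  \<open>j(U) = [N : N \<inter> U]\<close>, which is at most the index of \<open>U\<close>. Choosing coset representatives
  coordinatewise in \<open>N \<times> \<dots> \<times> N\<close> gives \<open>\<Prod>i. j(U\<^sub>i) \<le> j(U)\<close>, and a factor \<open>p\<close> is gained on the left
  if \<open>U\<close> does not cover \<open>N\<close> modulo \<open>N \<times> \<dots> \<times> N\<close> (\<open>rel_index_step\<close>, \<open>rel_index_drop\<close>). If \<open>U\<close> does cover \<open>N\<close> in
  this sense, each \<open>U\<^sub>i\<close> covers, modulo \<open>N\<close>, all sections of elements of \<open>N\<close>. There is a chain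
  \<open>N = L\<^sub>0, \<dots>, L\<^sub>k = G\<close> in which \<open>L\<^sub>s\<^sub>+\<^sub>1\<close> consists of sections of elements of \<open>L\<^sub>s\<close>; hence after \<open>k\<close> levels
  without gain the section groups cover \<open>G\<close> modulo \<open>N\<close>. While they go on covering \<open>G\<close> modulo
  \<open>N \<times> \<dots> \<times> N\<close>, they are transitive on level 1 and do not branch any more.

  Induction on \<open>j(U)\<close> turns this into \<open>o(U) \<le> (p^(k + 1) - 1) log\<^sub>p j(U) + p^k\<close> (\<open>orbits_bound\<close>). Since
  \<open>j(U) \<le> p^m\<close>, at most \<open>(p^(k + 1) - 1) m + p^k\<close> orbits occur. The chain has length \<open>k = 3\<close> for the
  Grigorchuk group and \<open>k = 1\<close> for the Gupta--Sidki groups, and for \<open>k \<le> 3\<close> and \<open>m \<ge> 1\<close> this number is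
  at most \<open>(p^5 - 1) m + 1\<close>.
\<close>

section \<open>Sections of tree automorphisms\<close>

type_synonym tree_map = "nat list \<Rightarrow> nat list"

text \<open>The coordinates of the wreath recursion: \<open>f (i # v)\<close> is \<open>root_perm f i # sect p f i v\<close> for a tree
  automorphism \<open>f\<close> (lemma \<open>apply_Cons\<close>). Sections are restricted to the vertices, because the elements
  of \<^term>\<open>tree_Aut p\<close> are extensional functions.\<close>

definition root_perm :: "tree_map \<Rightarrow> nat \<Rightarrow> nat" where
  "root_perm f i = hd (f [i])"

definition sect :: "nat \<Rightarrow> tree_map \<Rightarrow> nat \<Rightarrow> tree_map" where
  "sect p f i = (\<lambda>v \<in> tree_vertices p. tl (f (i # v)))"

definition tuple :: "nat \<Rightarrow> (nat \<Rightarrow> tree_map) \<Rightarrow> tree_map" where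
  "tuple p s = tuple_aut (map s [0..<p])"

text \<open>The ambient group is a locale parameter only for the sake of notation: as a structure it supplies
  the unindexed \<open>\<otimes>\<close>, \<open>inv\<close> and \<open>\<one>\<close>.\<close>

locale regular_tree =
  fixes p :: nat and A (structure)
  assumes A_def: "A = tree_Aut p"

sublocale regular_tree \<subseteq> group A
  unfolding A_def by (rule group_tree_Aut)

context regular_tree
begin

lemma carrier_A: "carrier A = tree_auts p"
  by (simp add: A_def carrier_tree_Aut)

lemma one_apply [simp]: "w \<in> tree_vertices p \<Longrightarrow> \<one> w = w"
  by (simp add: A_def one_tree_Aut)

lemma mult_apply [simp]:
  "\<lbrakk>f \<in> carrier A; g \<in> carrier A; w \<in> tree_vertices p\<rbrakk> \<Longrightarrow> (f \<otimes> g) w = f (g w)"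
  unfolding A_def carrier_tree_Aut by (simp add: mult_tree_Aut compose_def)

lemma apply_closed [simp]:
  "\<lbrakk>f \<in> carrier A; w \<in> tree_vertices p\<rbrakk> \<Longrightarrow> f w \<in> tree_vertices p"
  by (simp add: carrier_A tree_auts_closed)

lemma apply_Nil [simp]: "f \<in> carrier A \<Longrightarrow> f [] = []"
  by (simp add: carrier_A tree_auts_Nil)

lemma inv_apply [simp]:
  assumes "f \<in> carrier A" "w \<in> tree_vertices p"
  shows "(inv f) (f w) = w" "f ((inv f) w) = w"
  using assms mult_apply[of "inv f" f w] mult_apply[of f "inv f" w] by simp_all

lemma ext_A:
  assumes "f \<in> carrier A" "g \<in> carrier A" "\<And>w. w \<in> tree_vertices p \<Longrightarrow> f w = g w"
  shows "f = g"
proof (rule extensionalityI)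
  show "f \<in> extensional (tree_vertices p)" "g \<in> extensional (tree_vertices p)"
    using assms(1,2) unfolding carrier_A tree_auts_def Bij_def by blast+
qed (rule assms(3))

lemma apply_Cons_exists:
  assumes "f \<in> carrier A" "i < p" "v \<in> tree_vertices p"
  shows "\<exists>w. f (i # v) = root_perm f i # w"
  using assms(3)
proof (induction v rule: rev_induct)
  case Nil
  have "\<exists>j. f ([] @ [i]) = f [] @ [j]"
    using assms by (intro tree_auts_snoc) (auto simp: carrier_A)
  then show ?case using assms by (auto simp: root_perm_def)
next
  case (snoc j v)
  then obtain w where w: "f (i # v) = root_perm f i # w" by auto
  have "\<exists>l. f ((i # v) @ [j]) = f (i # v) @ [l]"
    using assms snoc.prems by (intro tree_auts_snoc) (auto simp: carrier_A)
  then show ?case using w by auto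
qed

lemma apply_Cons:
  assumes "f \<in> carrier A" "i < p" "v \<in> tree_vertices p"
  shows "f (i # v) = root_perm f i # sect p f i v"
  using apply_Cons_exists[OF assms] assms by (auto simp: sect_def)

lemma root_perm_less [simp]: "\<lbrakk>f \<in> carrier A; i < p\<rbrakk> \<Longrightarrow> root_perm f i < p"
  using apply_Cons[of f i "[]"] apply_closed[of f "[i]"] by auto

lemma sect_vertex: "\<lbrakk>f \<in> carrier A; i < p; v \<in> tree_vertices p\<rbrakk> \<Longrightarrow> sect p f i v \<in> tree_vertices p"
  using apply_Cons[of f i v] apply_closed[of f "i # v"] by auto

lemma sect_closed [simp]:
  assumes f: "f \<in> carrier A" and i: "i < p"
  shows "sect p f i \<in> carrier A"
  unfolding carrier_A
proof (rule tree_autsI)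
  show "sect p f i \<in> extensional (tree_vertices p)" by (simp add: sect_def)
  show "sect p f i [] = []"
    using apply_Cons_exists[OF f i, of "[]"] tree_auts_snoc[of f p "[]" i] f i
    by (auto simp: sect_def carrier_A tree_auts_Nil)
  show "sect p f i u \<in> tree_vertices p" if "u \<in> tree_vertices p" for u
    using sect_vertex f i that by blast
  show "inj_on (sect p f i) (tree_vertices p)"
  proof (rule inj_onI)
    fix u v assume uv: "u \<in> tree_vertices p" "v \<in> tree_vertices p" "sect p f i u = sect p f i v"
    then have "f (i # u) = f (i # v)"
      using apply_Cons[OF f i uv(1)] apply_Cons[OF f i uv(2)] by simp
    then have "i # u = i # v"
      using tree_auts_inj[of f p] f uv i by (auto simp: carrier_A dest: inj_onD)
    then show "u = v" by simp
  qed
  show "\<exists>j. sect p f i (u @ [l]) = sect p f i u @ [j]" if ul: "u @ [l] \<in> tree_vertices p" for u l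
  proof -
    obtain j where "f ((i # u) @ [l]) = f (i # u) @ [j]"
      using tree_auts_snoc[of f p "i # u" l] f i ul by (auto simp: carrier_A)
    moreover obtain w where "f (i # u) = root_perm f i # w"
      using apply_Cons_exists[OF f i, of u] ul by auto
    ultimately show ?thesis using ul by (simp add: sect_def)
  qed
qed

lemma
  assumes "f \<in> carrier A" "g \<in> carrier A" "i < p"
  shows root_perm_mult [simp]: "root_perm (f \<otimes> g) i = root_perm f (root_perm g i)"
    and sect_mult [simp]: "sect p (f \<otimes> g) i = sect p f (root_perm g i) \<otimes> sect p g i"
proof -
  have *: "(f \<otimes> g) (i # v) = root_perm f (root_perm g i) # sect p f (root_perm g i) (sect p g i v)"
    if "v \<in> tree_vertices p" for v
    using assms that by (simp add: apply_Cons[of g] apply_Cons[of f] sect_vertex)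
  from *[of "[]"] show "root_perm (f \<otimes> g) i = root_perm f (root_perm g i)"
    by (simp add: root_perm_def)
  show "sect p (f \<otimes> g) i = sect p f (root_perm g i) \<otimes> sect p g i"
    by (rule ext_A[OF sect_closed m_closed]) (use * assms in \<open>auto simp: sect_def[of p "f \<otimes> g"] sect_vertex\<close>)
qed

lemma
  assumes "i < p"
  shows root_perm_one [simp]: "root_perm \<one> i = i"
    and sect_one [simp]: "sect p \<one> i = \<one>"
proof -
  show "root_perm \<one> i = i" using assms by (simp add: root_perm_def)
  show "sect p \<one> i = \<one>"
    by (rule ext_A[OF sect_closed one_closed]) (use assms in \<open>auto simp: sect_def\<close>)
qed

lemma root_perm_inv_left [simp]:
  "\<lbrakk>f \<in> carrier A; i < p\<rbrakk> \<Longrightarrow> root_perm (inv f) (root_perm f i) = i"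
  using root_perm_mult[of "inv f" f i] by simp

lemma root_perm_inv_right [simp]:
  "\<lbrakk>f \<in> carrier A; i < p\<rbrakk> \<Longrightarrow> root_perm f (root_perm (inv f) i) = i"
  using root_perm_mult[of f "inv f" i] by simp

lemma root_perm_inv:
  "\<lbrakk>f \<in> carrier A; i < p; root_perm f i = j\<rbrakk> \<Longrightarrow> root_perm (inv f) j = i"
  by (metis root_perm_inv_left)

lemma sect_inv:
  assumes "f \<in> carrier A" "i < p" "root_perm f i = j"
  shows "sect p (inv f) j = inv (sect p f i)"
proof -
  have j: "j < p" using assms root_perm_less by blast
  have "sect p (inv f) j \<otimes> sect p f i = \<one>"
    using sect_mult[of "inv f" f i] assms by simp
  then show ?thesis using assms j by (intro inv_equality[symmetric]) auto
qed

text \<open>All group identities between tree automorphisms are checked one level down with this rule.\<close>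

lemma aut_eqI:
  assumes "f \<in> carrier A" "g \<in> carrier A"
    and "\<And>i. i < p \<Longrightarrow> root_perm f i = root_perm g i"
    and "\<And>i. i < p \<Longrightarrow> sect p f i = sect p g i"
  shows "f = g"
proof (rule ext_A)
  fix w assume w: "w \<in> tree_vertices p"
  show "f w = g w"
    using w assms(3,4) by (cases w) (simp_all add: apply_Cons assms(1,2))
qed fact+

lemma
  assumes "\<And>i. i < p \<Longrightarrow> s i \<in> carrier A"
  shows tuple_closed: "tuple p s \<in> carrier A"
    and root_perm_tuple: "i < p \<Longrightarrow> root_perm (tuple p s) i = i"
    and sect_tuple: "i < p \<Longrightarrow> sect p (tuple p s) i = s i"
proof -
  let ?F = "\<lambda>_ :: unit. \<lambda>w. case w of [] \<Rightarrow> [] | i # v \<Rightarrow> i # s i v"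
  have eq: "tuple p s = restrict (?F ()) (tree_vertices p)"
    by (auto simp: tuple_def tuple_aut_def fun_eq_iff split: list.split)
  have "restrict (?F ()) (tree_vertices p) \<in> tree_auts p"
  proof (rule word_recursion_in_tree_auts[where F = ?F])
    show "\<exists>\<psi>. (\<psi> \<in> tree_auts p \<or> \<psi> \<in> range ?F) \<and> (\<forall>v\<in>tree_vertices p. ?F k (i # v) = i # \<psi> v)"
      if "i < p" for k i
      using assms[OF that] by (intro exI[of _ "s i"]) (simp add: carrier_A)
  qed simp
  then show *: "tuple p s \<in> carrier A" by (simp add: eq carrier_A)
  show "root_perm (tuple p s) i = i" if "i < p" using that by (simp add: eq root_perm_def)
  show "sect p (tuple p s) i = s i" if "i < p"
    by (rule ext_A[OF sect_closed]) (use assms that * in \<open>simp_all add: sect_def\<close>, simp add: eq)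
qed

lemma rotation_closed: "p > 0 \<Longrightarrow> rotation p \<in> carrier A"
  by (simp add: carrier_A rotation_in_tree_auts)

lemma root_perm_rotation: "i < p \<Longrightarrow> root_perm (rotation p) i = (i + 1) mod p"
  by (simp add: root_perm_def rotation_def)

lemma sect_rotation: "i < p \<Longrightarrow> sect p (rotation p) i = \<one>"
  by (rule ext_A[OF sect_closed one_closed])
    (auto simp: rotation_closed, auto simp: sect_def rotation_def)

end

section \<open>Normal subgroups of a subgroup\<close>

context group
begin

lemma inv_cancel_left [simp]: "\<lbrakk>x \<in> carrier G; y \<in> carrier G\<rbrakk> \<Longrightarrow> inv x \<otimes> (x \<otimes> y) = y"
  by (simp flip: m_assoc)

lemma inv_cancel_right [simp]: "\<lbrakk>x \<in> carrier G; y \<in> carrier G\<rbrakk> \<Longrightarrow> x \<otimes> (inv x \<otimes> y) = y"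
  by (simp flip: m_assoc)

end

text \<open>Normality of \<open>N\<close> in a subgroup \<open>H\<close>, with all operations taken in \<open>G\<close>: several subgroups of one
  tree automorphism group are handled at once, and this avoids changing the carrier.\<close>

definition normal_in :: "('a, 'b) monoid_scheme \<Rightarrow> 'a set \<Rightarrow> 'a set \<Rightarrow> bool" where
  "normal_in G H N \<longleftrightarrow> subgroup N G \<and> N \<subseteq> H \<and>
     (\<forall>h \<in> H. \<forall>n \<in> N. h \<otimes>\<^bsub>G\<^esub> n \<otimes>\<^bsub>G\<^esub> inv\<^bsub>G\<^esub> h \<in> N)"

definition normal_closure :: "('a, 'b) monoid_scheme \<Rightarrow> 'a set \<Rightarrow> 'a set \<Rightarrow> 'a set" where
  "normal_closure G H S = generate G {h \<otimes>\<^bsub>G\<^esub> s \<otimes>\<^bsub>G\<^esub> inv\<^bsub>G\<^esub> h | h s. h \<in> H \<and> s \<in> S}"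

context group
begin

lemma normal_in_self: "subgroup H G \<Longrightarrow> normal_in G H H"
  by (auto simp: normal_in_def subgroup.m_closed subgroup.m_inv_closed)

lemma normal_in_conj:
  "\<lbrakk>normal_in G H N; h \<in> H; n \<in> N\<rbrakk> \<Longrightarrow> h \<otimes> n \<otimes> inv h \<in> N"
  by (simp add: normal_in_def)

lemma normal_in_conj':
  assumes "subgroup H G" "normal_in G H N" "h \<in> H" "n \<in> N"
  shows "inv h \<otimes> n \<otimes> h \<in> N"
  using normal_in_conj[OF assms(2) subgroup.m_inv_closed[OF assms(1,3)] assms(4)]
    subgroup.mem_carrier[OF assms(1,3)] by simp

lemma normal_closure_incl:
  assumes "subgroup H G" "S \<subseteq> H"
  shows "S \<subseteq> normal_closure G H S"
proof
  fix s assume s: "s \<in> S"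
  have "\<one> \<otimes> s \<otimes> inv \<one> \<in> normal_closure G H S"
    unfolding normal_closure_def
    by (intro generate.incl) (use s subgroup.one_closed[OF assms(1)] in blast)
  then show "s \<in> normal_closure G H S"
    using s assms subgroup.subset[OF assms(1)] by auto
qed

lemma normal_closure_minimal:
  assumes "subgroup M G" "S \<subseteq> M" "\<And>h n. \<lbrakk>h \<in> H; n \<in> M\<rbrakk> \<Longrightarrow> h \<otimes> n \<otimes> inv h \<in> M"
  shows "normal_closure G H S \<subseteq> M"
  unfolding normal_closure_def
  by (rule generate_subgroup_incl) (use assms in auto)

lemma normal_in_normal_closure:
  assumes H: "subgroup H G" and S: "S \<subseteq> H"
  shows "normal_in G H (normal_closure G H S)"
proof -
  let ?C = "{h \<otimes> s \<otimes> inv h | h s. h \<in> H \<and> s \<in> S}"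
  note HG = subgroup.mem_carrier[OF H]
  have CH: "?C \<subseteq> H"
    using S by (auto intro!: subgroup.m_closed[OF H] subgroup.m_inv_closed[OF H])
  then have CG: "?C \<subseteq> carrier G" using HG by blast
  have conj: "h \<otimes> n \<otimes> inv h \<in> generate G ?C" if h: "h \<in> H" and n: "n \<in> generate G ?C" for h n
    using n
  proof (induction n)
    case one
    then show ?case using h HG generate.one by auto
  next
    case (incl x)
    then obtain k s where ks: "k \<in> H" "s \<in> S" "x = k \<otimes> s \<otimes> inv k" by auto
    then have "h \<otimes> x \<otimes> inv h = (h \<otimes> k) \<otimes> s \<otimes> inv (h \<otimes> k)"
      using h HG S by (simp add: m_assoc inv_mult_group subset_iff)
    then show ?case using ks h subgroup.m_closed[OF H h ks(1)] by (intro generate.incl) blast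
  next
    case (inv x)
    then obtain k s where ks: "k \<in> H" "s \<in> S" "x = k \<otimes> s \<otimes> inv k" by auto
    then have "h \<otimes> inv x \<otimes> inv h = inv ((h \<otimes> k) \<otimes> s \<otimes> inv (h \<otimes> k))"
      using h HG S by (simp add: m_assoc inv_mult_group subset_iff)
    then show ?case using ks h subgroup.m_closed[OF H h ks(1)] by (simp only:) (intro generate.inv, blast)
  next
    case (eng x y)
    then have "x \<in> carrier G" "y \<in> carrier G" using generate_in_carrier[OF CG] by auto
    then have "h \<otimes> (x \<otimes> y) \<otimes> inv h = (h \<otimes> x \<otimes> inv h) \<otimes> (h \<otimes> y \<otimes> inv h)"
      using h HG by (simp add: m_assoc)
    then show ?case using eng by (simp add: generate.eng)
  qed
  show ?thesis
    unfolding normal_in_def normal_closure_def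
    using generate_is_subgroup[OF CG] generate_subgroup_incl[OF CH H] conj by blast
qed

text \<open>The elements that commute with \<open>y\<close> modulo \<open>M\<close> are the preimage of a centralizer in \<open>H / M\<close>.\<close>

lemma subgroup_centralizer_mod:
  assumes H: "subgroup H G" and M: "normal_in G H M" and y: "y \<in> H"
  shows "subgroup {x \<in> H. x \<otimes> y \<otimes> inv x \<otimes> inv y \<in> M} G"
proof (rule subgroupI)
  note HG = subgroup.mem_carrier[OF H]
  have Msub: "subgroup M G" using M by (simp add: normal_in_def)
  show "{x \<in> H. x \<otimes> y \<otimes> inv x \<otimes> inv y \<in> M} \<noteq> {}"
    using y HG subgroup.one_closed[OF H] subgroup.one_closed[OF Msub]
    by (auto intro!: exI[of _ \<one>])
next
  note HG = subgroup.mem_carrier[OF H]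
  have Msub: "subgroup M G" using M by (simp add: normal_in_def)
  fix x assume "x \<in> {x \<in> H. x \<otimes> y \<otimes> inv x \<otimes> inv y \<in> M}"
  then have x: "x \<in> H" "x \<otimes> y \<otimes> inv x \<otimes> inv y \<in> M" by auto
  have "inv x \<otimes> inv (x \<otimes> y \<otimes> inv x \<otimes> inv y) \<otimes> x \<in> M"
    using normal_in_conj'[OF H M x(1)] x(2) subgroup.m_inv_closed[OF Msub] by blast
  also have "inv x \<otimes> inv (x \<otimes> y \<otimes> inv x \<otimes> inv y) \<otimes> x = inv x \<otimes> y \<otimes> inv (inv x) \<otimes> inv y"
    using x y HG by (simp add: m_assoc inv_mult_group)
  finally show "inv x \<in> {x \<in> H. x \<otimes> y \<otimes> inv x \<otimes> inv y \<in> M}"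
    using x subgroup.m_inv_closed[OF H] by blast
next
  note HG = subgroup.mem_carrier[OF H]
  have Msub: "subgroup M G" using M by (simp add: normal_in_def)
  fix x z assume "x \<in> {x \<in> H. x \<otimes> y \<otimes> inv x \<otimes> inv y \<in> M}"
    "z \<in> {x \<in> H. x \<otimes> y \<otimes> inv x \<otimes> inv y \<in> M}"
  then have x: "x \<in> H" "x \<otimes> y \<otimes> inv x \<otimes> inv y \<in> M"
    and z: "z \<in> H" "z \<otimes> y \<otimes> inv z \<otimes> inv y \<in> M" by auto
  have "(x \<otimes> (z \<otimes> y \<otimes> inv z \<otimes> inv y) \<otimes> inv x) \<otimes> (x \<otimes> y \<otimes> inv x \<otimes> inv y) \<in> M"
    using normal_in_conj[OF M x(1) z(2)] x(2) subgroup.m_closed[OF Msub] by blast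
  also have "(x \<otimes> (z \<otimes> y \<otimes> inv z \<otimes> inv y) \<otimes> inv x) \<otimes> (x \<otimes> y \<otimes> inv x \<otimes> inv y)
      = (x \<otimes> z) \<otimes> y \<otimes> inv (x \<otimes> z) \<otimes> inv y"
    using x y z HG by (simp add: m_assoc inv_mult_group)
  finally show "x \<otimes> z \<in> {x \<in> H. x \<otimes> y \<otimes> inv x \<otimes> inv y \<in> M}"
    using x z subgroup.m_closed[OF H] by blast
qed (use subgroup.subset[OF H] in blast)

text \<open>Commutativity of \<open>H / M\<close> can be tested on generators, by two applications of the centralizer.\<close>

lemma commutators_in_normal:
  assumes H: "subgroup H G" and M: "normal_in G H M"
    and gen: "H \<subseteq> generate G S" "S \<subseteq> H"
    and comm: "\<And>s t. \<lbrakk>s \<in> S; t \<in> S\<rbrakk> \<Longrightarrow> s \<otimes> t \<otimes> inv s \<otimes> inv t \<in> M"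
    and xy: "x \<in> H" "y \<in> H"
  shows "x \<otimes> y \<otimes> inv x \<otimes> inv y \<in> M"
proof -
  note HG = subgroup.mem_carrier[OF H]
  have Msub: "subgroup M G" and MH: "M \<subseteq> H" using M by (auto simp: normal_in_def)
  note centralizer = subgroup_centralizer_mod[OF H M]
  have flip: "y \<otimes> x \<otimes> inv y \<otimes> inv x \<in> M"
    if "x \<in> H" "y \<in> H" "x \<otimes> y \<otimes> inv x \<otimes> inv y \<in> M" for x y
  proof -
    have "inv (x \<otimes> y \<otimes> inv x \<otimes> inv y) = y \<otimes> x \<otimes> inv y \<otimes> inv x"
      using that HG by (simp add: m_assoc inv_mult_group)
    then show ?thesis using subgroup.m_inv_closed[OF Msub that(3)] by simp
  qed
  have 1: "x \<otimes> t \<otimes> inv x \<otimes> inv t \<in> M" if "x \<in> H" "t \<in> S" for x t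
  proof -
    have "generate G S \<subseteq> {x \<in> H. x \<otimes> t \<otimes> inv x \<otimes> inv t \<in> M}"
      by (rule generate_subgroup_incl[OF _ centralizer]) (use gen comm that in auto)
    then show ?thesis using that gen by blast
  qed
  have "generate G S \<subseteq> {z \<in> H. z \<otimes> x \<otimes> inv z \<otimes> inv x \<in> M}"
    by (rule generate_subgroup_incl[OF _ centralizer]) (use 1 flip gen xy in auto)
  then show ?thesis using flip gen xy by blast
qed

text \<open>In the abelian group \<open>H / M\<close>, taking \<open>n\<close>-th powers is a homomorphism.\<close>

lemma subgroup_powers_in:
  assumes H: "subgroup H G" and M: "normal_in G H M"
    and comm: "\<And>x y. \<lbrakk>x \<in> H; y \<in> H\<rbrakk> \<Longrightarrow> x \<otimes> y \<otimes> inv x \<otimes> inv y \<in> M"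
  shows "subgroup {x \<in> H. x [^] (n :: nat) \<in> M} G"
proof (rule subgroupI)
  note HG = subgroup.mem_carrier[OF H]
  have Msub: "subgroup M G" using M by (auto simp: normal_in_def)
  note MG = subgroup.mem_carrier[OF Msub]
  have powH: "x [^] (k :: nat) \<in> H" if "x \<in> H" for x k
    by (induction k) (use that H in \<open>auto intro: subgroup.m_closed subgroup.one_closed\<close>)
  show "{x \<in> H. x [^] n \<in> M} \<subseteq> carrier G" using HG by blast
  show "{x \<in> H. x [^] n \<in> M} \<noteq> {}"
    using subgroup.one_closed[OF H] subgroup.one_closed[OF Msub] by auto
  show "inv x \<in> {x \<in> H. x [^] n \<in> M}" if "x \<in> {x \<in> H. x [^] n \<in> M}" for x
    using that HG subgroup.m_inv_closed[OF H] subgroup.m_inv_closed[OF Msub]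
    by (auto simp: nat_pow_inv)
  have mult: "\<exists>m \<in> M. (x \<otimes> y) [^] (k :: nat) = m \<otimes> (x [^] k \<otimes> y [^] k)"
    if x: "x \<in> H" and y: "y \<in> H" for x y k
  proof (induction k)
    case 0
    then show ?case using subgroup.one_closed[OF Msub] by (auto intro!: bexI[of _ \<one>])
  next
    case (Suc k)
    then obtain m where m: "m \<in> M" "(x \<otimes> y) [^] k = m \<otimes> (x [^] k \<otimes> y [^] k)" by blast
    define c where "c = y [^] k \<otimes> x \<otimes> inv (y [^] k) \<otimes> inv x"
    have c: "c \<in> M" unfolding c_def using comm[OF powH[OF y] x] .
    have G: "x \<in> carrier G" "y \<in> carrier G" "m \<in> carrier G" "c \<in> carrier G"
      using HG MG x y m c by auto
    have "(x \<otimes> y) [^] Suc k = m \<otimes> (x [^] k \<otimes> ((y [^] k \<otimes> x) \<otimes> y))"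
      using G by (simp add: m m_assoc)
    also have "y [^] k \<otimes> x = c \<otimes> (x \<otimes> y [^] k)"
      using G by (simp add: c_def m_assoc)
    also have "m \<otimes> (x [^] k \<otimes> ((c \<otimes> (x \<otimes> y [^] k)) \<otimes> y))
        = (m \<otimes> (x [^] k \<otimes> c \<otimes> inv (x [^] k))) \<otimes> (x [^] Suc k \<otimes> y [^] Suc k)"
      using G by (simp add: m_assoc)
    finally show ?case
      using subgroup.m_closed[OF Msub m(1) normal_in_conj[OF M powH[OF x] c]] by blast
  qed
  show "x \<otimes> y \<in> {x \<in> H. x [^] n \<in> M}"
    if "x \<in> {x \<in> H. x [^] n \<in> M}" "y \<in> {x \<in> H. x [^] n \<in> M}" for x y
    using that mult[of x y n] subgroup.m_closed[OF H] subgroup.m_closed[OF Msub] by auto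
qed

lemma set_multI: "\<lbrakk>h \<in> U; k \<in> M\<rbrakk> \<Longrightarrow> h \<otimes> k \<in> U <#> M"
  by (auto simp: set_mult_def)

lemma subgroup_set_mult:
  assumes U: "subgroup U G" "U \<subseteq> H" and M: "normal_in G H M" and H: "subgroup H G"
  shows "subgroup (U <#> M) G"
proof -
  note UG = subgroup.mem_carrier[OF U(1)]
  have Msub: "subgroup M G" using M by (auto simp: normal_in_def)
  note MG = subgroup.mem_carrier[OF Msub]
  have *: "m \<otimes> u \<in> U <#> M" if "u \<in> U" "m \<in> M" for u m
  proof -
    have "m \<otimes> u = u \<otimes> (inv u \<otimes> m \<otimes> u)" using UG MG that by (simp add: m_assoc)
    then show ?thesis using normal_in_conj'[OF H M, of u m] U that set_multI by auto
  qed
  show ?thesis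
  proof (rule subgroupI)
    show "U <#> M \<subseteq> carrier G" using UG MG by (auto simp: set_mult_def)
    show "U <#> M \<noteq> {}"
      using set_multI subgroup.one_closed[OF U(1)] subgroup.one_closed[OF Msub] by blast
  next
    fix x assume "x \<in> U <#> M"
    then obtain u m where um: "u \<in> U" "m \<in> M" "x = u \<otimes> m" by (auto simp: set_mult_def)
    then show "inv x \<in> U <#> M"
      using *[of "inv u" "inv m"] subgroup.m_inv_closed[OF U(1)] subgroup.m_inv_closed[OF Msub] UG MG
      by (simp add: inv_mult_group)
  next
    fix x y assume "x \<in> U <#> M" "y \<in> U <#> M"
    then obtain u m v n where um: "u \<in> U" "m \<in> M" "x = u \<otimes> m" "v \<in> U" "n \<in> M" "y = v \<otimes> n"
      by (auto simp: set_mult_def)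
    obtain w l where wl: "w \<in> U" "l \<in> M" "m \<otimes> v = w \<otimes> l"
      using *[of v m] um by (auto simp: set_mult_def)
    have "x \<otimes> y = u \<otimes> ((m \<otimes> v) \<otimes> n)" using um UG MG by (simp add: m_assoc)
    also have "\<dots> = (u \<otimes> w) \<otimes> (l \<otimes> n)" unfolding wl(3) using um wl UG MG by (simp add: m_assoc)
    finally show "x \<otimes> y \<in> U <#> M"
      using set_multI subgroup.m_closed[OF U(1)] subgroup.m_closed[OF Msub] um wl by auto
  qed
qed

lemma rcos_eq_iff:
  assumes "subgroup U G" "x \<in> carrier G" "y \<in> carrier G"
  shows "U #> x = U #> y \<longleftrightarrow> x \<otimes> inv y \<in> U"
  using subgroup.rcos_module[OF assms(1) is_group assms(3,2)]
    repr_independence[OF _ assms(3,1)] rcos_self[OF assms(2,1)]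
  by metis

end

section \<open>Groups of sections\<close>

context regular_tree
begin

text \<open>\<open>tuples M\<close> is the geometric product \<open>M \<times> \<dots> \<times> M\<close> acting on the \<open>p\<close> subtrees, \<open>inject\<close> is its first
  coordinate embedding, and \<open>sect_group U i\<close> is the image of the stabilizer of the vertex \<open>i\<close> in \<open>U\<close>
  under the section map.\<close>

definition tuples :: "tree_map set \<Rightarrow> tree_map set" where
  "tuples M = {f \<in> carrier A. \<forall>i < p. root_perm f i = i \<and> sect p f i \<in> M}"

definition inject :: "tree_map \<Rightarrow> tree_map" where
  "inject n = tuple p (\<lambda>i. if i = 0 then n else \<one>)"

definition sect_group :: "tree_map set \<Rightarrow> nat \<Rightarrow> tree_map set" where
  "sect_group U i = {sect p u i | u. u \<in> U \<and> root_perm u i = i}"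

lemma tuple_in_tuples: "\<lbrakk>M \<subseteq> carrier A; \<And>i. i < p \<Longrightarrow> s i \<in> M\<rbrakk> \<Longrightarrow> tuple p s \<in> tuples M"
  unfolding tuples_def by (simp add: tuple_closed root_perm_tuple sect_tuple subset_iff)

lemma subgroup_sect_group:
  assumes U: "subgroup U A" and i: "i < p"
  shows "subgroup (sect_group U i) A"
proof (rule subgroupI)
  note UA = subgroup.mem_carrier[OF U]
  show "sect_group U i \<subseteq> carrier A" using UA i by (auto simp: sect_group_def)
  have "sect p \<one> i \<in> sect_group U i"
    using i subgroup.one_closed[OF U] unfolding sect_group_def by fastforce
  then show "sect_group U i \<noteq> {}" by blast
next
  note UA = subgroup.mem_carrier[OF U]
  fix x assume "x \<in> sect_group U i"
  then obtain u where u: "u \<in> U" "root_perm u i = i" "x = sect p u i" by (auto simp: sect_group_def)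
  then have "inv x = sect p (inv u) i" "root_perm (inv u) i = i"
    using sect_inv[of u i i] root_perm_inv[of u i i] UA i by auto
  then show "inv x \<in> sect_group U i"
    using subgroup.m_inv_closed[OF U u(1)] unfolding sect_group_def by blast
next
  note UA = subgroup.mem_carrier[OF U]
  fix x y assume "x \<in> sect_group U i" "y \<in> sect_group U i"
  then obtain u v where uv: "u \<in> U" "root_perm u i = i" "x = sect p u i"
      "v \<in> U" "root_perm v i = i" "y = sect p v i" by (auto simp: sect_group_def)
  then have "x \<otimes> y = sect p (u \<otimes> v) i" "root_perm (u \<otimes> v) i = i" using UA i by auto
  then show "x \<otimes> y \<in> sect_group U i"
    using subgroup.m_closed[OF U uv(1,4)] unfolding sect_group_def by blast
qed

lemma sect_groupI: "\<lbrakk>u \<in> U; root_perm u i = i; sect p u i = g\<rbrakk> \<Longrightarrow> g \<in> sect_group U i"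
  by (auto simp: sect_group_def)

lemma subgroup_tuples:
  assumes M: "subgroup M A"
  shows "subgroup (tuples M) A"
proof (rule subgroupI)
  have "\<one> \<in> tuples M" using subgroup.one_closed[OF M] by (simp add: tuples_def)
  then show "tuples M \<noteq> {}" by blast
  show "inv f \<in> tuples M" if "f \<in> tuples M" for f
    using that root_perm_inv[of f] sect_inv[of f] subgroup.m_inv_closed[OF M]
    by (auto simp: tuples_def)
qed (use subgroup.m_closed[OF M] in \<open>auto simp: tuples_def\<close>)

lemma inject_closed: "n \<in> carrier A \<Longrightarrow> inject n \<in> carrier A"
  unfolding inject_def by (rule tuple_closed) simp

lemma root_perm_inject: "\<lbrakk>n \<in> carrier A; i < p\<rbrakk> \<Longrightarrow> root_perm (inject n) i = i"
  unfolding inject_def by (rule root_perm_tuple) simp_all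

lemma sect_inject: "\<lbrakk>n \<in> carrier A; i < p\<rbrakk> \<Longrightarrow> sect p (inject n) i = (if i = 0 then n else \<one>)"
  unfolding inject_def by (subst sect_tuple) simp_all

lemma inject_mult:
  "\<lbrakk>m \<in> carrier A; n \<in> carrier A\<rbrakk> \<Longrightarrow> inject (m \<otimes> n) = inject m \<otimes> inject n"
  by (rule aut_eqI) (simp_all add: inject_closed root_perm_inject sect_inject)

lemma inject_one: "inject \<one> = \<one>"
  by (rule aut_eqI) (simp_all add: inject_closed root_perm_inject sect_inject)

lemma inject_inv: "n \<in> carrier A \<Longrightarrow> inject (inv n) = inv (inject n)"
  using inject_mult[of "inv n" n] by (intro inv_equality[symmetric]) (simp_all add: inject_closed inject_one)

text \<open>Below every vertex except \<open>0\<close> the two elements commute, so only the first coordinate of their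
  commutator survives. This is how elements of \<open>N \<times> 1 \<times> \<dots> \<times> 1\<close> are found inside \<open>N\<close>.\<close>

lemma commutator_eq_inject:
  assumes x: "x \<in> carrier A" and y: "y \<in> carrier A" and p: "0 < p"
    and stab: "\<And>i. i < p \<Longrightarrow> root_perm x i = i" "\<And>i. i < p \<Longrightarrow> root_perm y i = i"
    and comm: "\<And>i. \<lbrakk>0 < i; i < p\<rbrakk> \<Longrightarrow> sect p x i \<otimes> sect p y i = sect p y i \<otimes> sect p x i"
  shows "x \<otimes> y \<otimes> inv x \<otimes> inv y
    = inject (sect p x 0 \<otimes> sect p y 0 \<otimes> inv (sect p x 0) \<otimes> inv (sect p y 0))" (is "_ = inject ?n")
proof -
  have n: "?n \<in> carrier A" using x y p by simp
  have "x \<otimes> y = inject ?n \<otimes> (y \<otimes> x)"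
  proof (rule aut_eqI)
    fix i assume i: "i < p"
    show "root_perm (x \<otimes> y) i = root_perm (inject ?n \<otimes> (y \<otimes> x)) i"
      using i x y n by (simp add: stab inject_closed root_perm_inject)
    show "sect p (x \<otimes> y) i = sect p (inject ?n \<otimes> (y \<otimes> x)) i"
    proof (cases "i = 0")
      case True
      then show ?thesis
        using x y n p by (simp add: stab inject_closed sect_inject m_assoc)
    next
      case False
      then show ?thesis
        using x y n i comm[of i] by (simp add: stab inject_closed sect_inject)
    qed
  qed (use x y n inject_closed in auto)
  then have "x \<otimes> y \<otimes> inv x \<otimes> inv y = (inject ?n \<otimes> (y \<otimes> x)) \<otimes> inv x \<otimes> inv y" by simp
  also have "\<dots> = inject ?n" using x y inject_closed[OF n] by (simp add: m_assoc)
  finally show ?thesis .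
qed

lemma sect_generate:
  assumes S: "S \<subseteq> carrier A" and sect_S: "\<And>s i. \<lbrakk>s \<in> S; i < p\<rbrakk> \<Longrightarrow> sect p s i \<in> generate A S"
    and f: "f \<in> generate A S"
  shows "i < p \<Longrightarrow> sect p f i \<in> generate A S"
  using f
proof (induction arbitrary: i)
  case one
  then show ?case by (simp add: generate.one)
next
  case (incl h)
  then show ?case using sect_S by blast
next
  case (inv h)
  then have h: "h \<in> carrier A" using S by blast
  let ?j = "root_perm (inv h) i"
  have "sect p (inv h) i = inv (sect p h ?j)"
    using sect_inv[of h ?j i] h inv.prems by simp
  then show ?case
    using generate_m_inv_closed[OF S sect_S[OF inv.hyps, of ?j]] h inv.prems by simp
next
  case (eng f g)
  then have A: "f \<in> carrier A" "g \<in> carrier A" using generate_in_carrier[OF S] by auto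
  then show ?case
    using eng.IH(1)[of "root_perm g i"] eng.IH(2)[of i] eng.prems by (simp add: generate.eng)
qed

text \<open>Conjugating \<open>inject n\<close> by an element of \<open>H\<close> that fixes the vertex \<open>0\<close> and has section \<open>h\<close> there
  conjugates \<open>n\<close> by \<open>h\<close>, and every \<open>h \<in> H\<close> occurs. Hence \<open>inject n \<in> N\<close> need only be checked for
  normal generators \<open>n\<close>.\<close>

lemma normal_in_inject:
  assumes H: "subgroup H A" and N: "normal_in A H N" and onto: "H \<subseteq> sect_group H 0" and p: "0 < p"
  shows "normal_in A H {n \<in> H. inject n \<in> N}"
proof -
  note HA = subgroup.mem_carrier[OF H]
  have Nsub: "subgroup N A" using N by (simp add: normal_in_def)
  have conj: "h \<otimes> n \<otimes> inv h \<in> H \<and> inject (h \<otimes> n \<otimes> inv h) \<in> N"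
    if h: "h \<in> H" and n: "n \<in> H" "inject n \<in> N" for h n
  proof
    show "h \<otimes> n \<otimes> inv h \<in> H"
      using h n subgroup.m_closed[OF H] subgroup.m_inv_closed[OF H] by blast
    obtain x where x: "x \<in> H" "root_perm x 0 = 0" "sect p x 0 = h"
      using onto h by (auto simp: sect_group_def)
    have A: "x \<in> carrier A" "h \<in> carrier A" "n \<in> carrier A" using HA x h n by auto
    have hn: "h \<otimes> n \<otimes> inv h \<in> carrier A" using A by simp
    have "x \<otimes> inject n = inject (h \<otimes> n \<otimes> inv h) \<otimes> x"
    proof (rule aut_eqI)
      fix i assume i: "i < p"
      show "root_perm (x \<otimes> inject n) i = root_perm (inject (h \<otimes> n \<otimes> inv h) \<otimes> x) i"
        using A hn i by (simp add: inject_closed root_perm_inject)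
      have "root_perm x i = 0 \<longleftrightarrow> i = 0"
        using x root_perm_inv[OF A(1) i] root_perm_inv[OF A(1) p x(2)] by metis
      then show "sect p (x \<otimes> inject n) i = sect p (inject (h \<otimes> n \<otimes> inv h) \<otimes> x) i"
        using A hn i x by (simp add: inject_closed root_perm_inject sect_inject m_assoc)
    qed (use A hn inject_closed in auto)
    then have "x \<otimes> inject n \<otimes> inv x = inject (h \<otimes> n \<otimes> inv h)"
      using A inject_closed[OF hn] by (simp add: m_assoc)
    then show "inject (h \<otimes> n \<otimes> inv h) \<in> N" using normal_in_conj[OF N x(1) n(2)] by simp
  qed
  have "subgroup {n \<in> H. inject n \<in> N} A"
  proof (rule subgroupI)
    have "\<one> \<in> {n \<in> H. inject n \<in> N}"
      using subgroup.one_closed[OF H] subgroup.one_closed[OF Nsub] by (simp add: inject_one)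
    then show "{n \<in> H. inject n \<in> N} \<noteq> {}" by blast
  qed (use HA subgroup.m_closed[OF H] subgroup.m_closed[OF Nsub] subgroup.m_inv_closed[OF H]
      subgroup.m_inv_closed[OF Nsub] in \<open>auto simp: inject_mult inject_inv\<close>)
  then show ?thesis using conj by (auto simp: normal_in_def)
qed

text \<open>By the same conjugation argument the sections at \<open>i\<close> of a normal subgroup form a normal subgroup.\<close>

lemma normal_closure_subset_sect_group:
  assumes H: "subgroup H A" and onto: "H \<subseteq> sect_group H i" and i: "i < p"
    and M: "normal_in A H M" and S: "S \<subseteq> sect_group M i"
  shows "normal_closure A H S \<subseteq> sect_group M i"
proof (rule normal_closure_minimal[OF _ S])
  have Msub: "subgroup M A" using M by (simp add: normal_in_def)
  show "subgroup (sect_group M i) A" by (rule subgroup_sect_group[OF Msub i])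
  fix h n assume "h \<in> H" "n \<in> sect_group M i"
  then obtain x y where x: "x \<in> H" "root_perm x i = i" "sect p x i = h"
    and y: "y \<in> M" "root_perm y i = i" "sect p y i = n"
    using onto by (auto simp: sect_group_def)
  have A: "x \<in> carrier A" "y \<in> carrier A"
    using subgroup.mem_carrier[OF H x(1)] subgroup.mem_carrier[OF Msub y(1)] by auto
  have "x \<otimes> y \<otimes> inv x \<in> M" by (rule normal_in_conj[OF M x(1) y(1)])
  moreover have "root_perm (x \<otimes> y \<otimes> inv x) i = i" "sect p (x \<otimes> y \<otimes> inv x) i = h \<otimes> n \<otimes> inv h"
    using A x y i root_perm_inv[OF A(1) i x(2)] sect_inv[OF A(1) i x(2)] by simp_all
  ultimately show "h \<otimes> n \<otimes> inv h \<in> sect_group M i" by (rule sect_groupI)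
qed

lemma rotation_conj:
  assumes x: "x \<in> carrier A" and i: "Suc i < p"
    and r: "root_perm x i = i"
  shows "root_perm (rotation p \<otimes> x \<otimes> inv (rotation p)) (Suc i) = Suc i"
    and "sect p (rotation p \<otimes> x \<otimes> inv (rotation p)) (Suc i) = sect p x i"
proof -
  have p: "p > 0" and i': "i < p" using i by auto
  note a = rotation_closed[OF p]
  have ra: "root_perm (rotation p) i = Suc i" using i by (simp add: root_perm_rotation)
  have ri: "root_perm (inv (rotation p)) (Suc i) = i" using root_perm_inv[OF a i' ra] .
  have si: "sect p (inv (rotation p)) (Suc i) = \<one>"
    using sect_inv[OF a i' ra] i' by (simp add: sect_rotation)
  show "root_perm (rotation p \<otimes> x \<otimes> inv (rotation p)) (Suc i) = Suc i"
    using x a i i' r ra ri by simp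
  show "sect p (rotation p \<otimes> x \<otimes> inv (rotation p)) (Suc i) = sect p x i"
    using x a i i' r ra ri si by (simp add: sect_rotation)
qed

end

section \<open>Rays and orbits\<close>

definition cons_ray :: "nat \<Rightarrow> (nat \<Rightarrow> nat list) \<Rightarrow> nat \<Rightarrow> nat list" where
  "cons_ray i \<rho> n = (case n of 0 \<Rightarrow> [] | Suc m \<Rightarrow> i # \<rho> m)"

lemma cons_ray_in_boundary:
  "\<lbrakk>i < p; \<rho> \<in> tree_boundary p\<rbrakk> \<Longrightarrow> cons_ray i \<rho> \<in> tree_boundary p"
  by (auto simp: tree_boundary_def cons_ray_def is_child_def split: nat.split)

lemma boundary_cases:
  assumes \<xi>: "\<xi> \<in> tree_boundary p"
  obtains i \<rho> where "i < p" "\<rho> \<in> tree_boundary p" "\<xi> = cons_ray i \<rho>"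
proof -
  have \<xi>0: "\<xi> 0 = []" and V: "\<xi> n \<in> tree_vertices p" and child: "is_child (\<xi> n) (\<xi> (Suc n))" for n
    using \<xi> by (auto simp: tree_boundary_def)
  obtain i where i: "\<xi> (Suc 0) = [i]" using child[of 0] \<xi>0 by (auto simp: is_child_def)
  define \<rho> where "\<rho> n = tl (\<xi> (Suc n))" for n
  have \<rho>: "\<xi> (Suc n) = i # \<rho> n" for n
  proof (induction n)
    case (Suc n)
    obtain j where "\<xi> (Suc (Suc n)) = \<xi> (Suc n) @ [j]"
      using child[of "Suc n"] by (auto simp: is_child_def)
    then have "\<xi> (Suc (Suc n)) = i # (\<rho> n @ [j])" by (simp only: Suc.IH append_Cons)
    then show ?case by (simp add: \<rho>_def)
  qed (simp add: i \<rho>_def)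
  have "is_child (\<rho> n) (\<rho> (Suc n))" for n
    using child[of "Suc n"] by (auto simp: \<rho> is_child_def)
  moreover have "i < p" "\<rho> n \<in> tree_vertices p" for n using V[of "Suc n"] by (auto simp: \<rho>)
  moreover have "\<rho> 0 = []" using i by (simp add: \<rho>_def)
  moreover have "\<xi> = cons_ray i \<rho>" by (auto simp: cons_ray_def \<xi>0 \<rho> split: nat.split)
  ultimately show ?thesis by (intro that[of i \<rho>]) (auto simp: tree_boundary_def)
qed

lemma boundary_vertex: "\<rho> \<in> tree_boundary p \<Longrightarrow> \<rho> n \<in> tree_vertices p"
  by (simp add: tree_boundary_def)

text \<open>At most \<open>r\<close> orbits of \<open>U\<close> meet the \<open>H\<close>-orbit of \<open>\<xi>\<close>. The representatives in \<open>R\<close> may lie outside that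
  orbit; so when representatives for a subtree are moved into the whole tree, it does not matter
  whether they stay in the orbit of the extended ray.\<close>

definition orbits_le ::
    "nat \<Rightarrow> tree_map set \<Rightarrow> tree_map set \<Rightarrow> (nat \<Rightarrow> nat list) \<Rightarrow> nat \<Rightarrow> bool" where
  "orbits_le p H U \<xi> r \<longleftrightarrow> (\<exists>R. finite R \<and> card R \<le> r \<and> R \<subseteq> tree_boundary p \<and>
     (\<forall>g \<in> H. \<exists>\<rho> \<in> R. \<exists>u \<in> U. g \<circ> \<xi> = u \<circ> \<rho>))"

context regular_tree
begin

lemma comp_cons_ray:
  "\<lbrakk>f \<in> carrier A; i < p; \<rho> \<in> tree_boundary p\<rbrakk> \<Longrightarrow>
     f \<circ> cons_ray i \<rho> = cons_ray (root_perm f i) (sect p f i \<circ> \<rho>)"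
  by (auto simp: cons_ray_def apply_Cons boundary_vertex split: nat.split)

lemma comp_mult:
  "\<lbrakk>f \<in> carrier A; g \<in> carrier A; \<rho> \<in> tree_boundary p\<rbrakk> \<Longrightarrow> (f \<otimes> g) \<circ> \<rho> = f \<circ> (g \<circ> \<rho>)"
  by (auto simp: boundary_vertex)

text \<open>A ray in the \<open>H\<close>-orbit of \<open>i0 # \<xi>\<close> that passes through \<open>i\<close> continues with an element of the \<open>H\<close>-orbit
  of \<open>\<xi>\<close>, and below \<open>i\<close> the stabilizer of \<open>i\<close> in \<open>U\<close> acts through \<open>sect_group U i\<close>.\<close>

lemma orbits_le_sum:
  assumes U: "U \<subseteq> carrier A" and H: "H \<subseteq> carrier A"
    and sect_H: "\<And>f i. \<lbrakk>f \<in> H; i < p\<rbrakk> \<Longrightarrow> sect p f i \<in> H"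
    and i0: "i0 < p" and \<xi>: "\<xi> \<in> tree_boundary p"
    and le: "\<And>i. i < p \<Longrightarrow> orbits_le p H (sect_group U i) \<xi> (r i)"
  shows "orbits_le p H U (cons_ray i0 \<xi>) (\<Sum>i<p. r i)"
proof -
  from le obtain R where R: "\<And>i. i < p \<Longrightarrow> finite (R i) \<and> card (R i) \<le> r i \<and>
      R i \<subseteq> tree_boundary p \<and> (\<forall>g \<in> H. \<exists>\<rho> \<in> R i. \<exists>u \<in> sect_group U i. g \<circ> \<xi> = u \<circ> \<rho>)"
    unfolding orbits_le_def by metis
  let ?R = "\<Union>i<p. cons_ray i ` R i"
  have "card ?R \<le> (\<Sum>i<p. card (cons_ray i ` R i))" by (rule card_UN_le) simp
  also have "\<dots> \<le> (\<Sum>i<p. r i)"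
    using R by (intro sum_mono) (meson card_image_le lessThan_iff order_trans)
  finally have "card ?R \<le> (\<Sum>i<p. r i)" .
  moreover have "finite ?R" "?R \<subseteq> tree_boundary p"
    using R cons_ray_in_boundary by (auto, blast)
  moreover have "\<exists>\<rho> \<in> ?R. \<exists>u \<in> U. g \<circ> cons_ray i0 \<xi> = u \<circ> \<rho>" if g: "g \<in> H" for g
  proof -
    let ?i = "root_perm g i0"
    have i: "?i < p" using g H i0 by auto
    obtain \<rho> v where \<rho>: "\<rho> \<in> R ?i" and v: "v \<in> sect_group U ?i" "sect p g i0 \<circ> \<xi> = v \<circ> \<rho>"
      using R[OF i] sect_H[OF g i0] by blast
    obtain u where u: "u \<in> U" "root_perm u ?i = ?i" "v = sect p u ?i"
      using v(1) by (auto simp: sect_group_def)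
    have "g \<circ> cons_ray i0 \<xi> = u \<circ> cons_ray ?i \<rho>"
      using comp_cons_ray[OF subsetD[OF H g] i0 \<xi>]
        comp_cons_ray[OF subsetD[OF U u(1)] i, of \<rho>] u(2,3) v(2) R[OF i] \<rho>
      by (simp add: subset_iff)
    then show ?thesis using u(1) \<rho> i by blast
  qed
  ultimately show ?thesis unfolding orbits_le_def by (intro exI[of _ ?R] conjI ballI)
qed

text \<open>If \<open>U\<close> can move every ray below the vertex \<open>i\<close>, counting orbits there is enough.\<close>

lemma orbits_le_transitive:
  assumes U: "subgroup U A" "U \<subseteq> H" and H: "subgroup H A"
    and sect_H: "\<And>f i. \<lbrakk>f \<in> H; i < p\<rbrakk> \<Longrightarrow> sect p f i \<in> H"
    and i0: "i0 < p" and \<xi>: "\<xi> \<in> tree_boundary p" and i: "i < p"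
    and trans: "\<And>j. j < p \<Longrightarrow> \<exists>u \<in> U. root_perm u j = i"
    and le: "orbits_le p H (sect_group U i) \<xi> r"
  shows "orbits_le p H U (cons_ray i0 \<xi>) r"
proof -
  note UA = subgroup.mem_carrier[OF U(1)] and HA = subgroup.mem_carrier[OF H]
  from le obtain R where R: "finite R" "card R \<le> r" "R \<subseteq> tree_boundary p"
     "\<And>g. g \<in> H \<Longrightarrow> \<exists>\<rho> \<in> R. \<exists>u \<in> sect_group U i. g \<circ> \<xi> = u \<circ> \<rho>"
    unfolding orbits_le_def by metis
  let ?R = "cons_ray i ` R"
  have "finite ?R" "card ?R \<le> r" "?R \<subseteq> tree_boundary p"
    using R cons_ray_in_boundary[OF i] card_image_le[OF R(1), of "cons_ray i"] by auto
  moreover have "\<exists>\<rho> \<in> ?R. \<exists>u \<in> U. g \<circ> cons_ray i0 \<xi> = u \<circ> \<rho>" if g: "g \<in> H" for g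
  proof -
    obtain w where w: "w \<in> U" "root_perm w (root_perm g i0) = i"
      using trans[of "root_perm g i0"] g HA i0 by auto
    define h where "h = w \<otimes> g"
    have h: "h \<in> H" "root_perm h i0 = i"
      using w g U HA i0 subgroup.m_closed[OF H] by (auto simp: h_def)
    obtain \<rho> v where \<rho>: "\<rho> \<in> R" and v: "v \<in> sect_group U i" "sect p h i0 \<circ> \<xi> = v \<circ> \<rho>"
      using R(4)[OF sect_H[OF h(1) i0]] by blast
    obtain u where u: "u \<in> U" "root_perm u i = i" "v = sect p u i"
      using v(1) by (auto simp: sect_group_def)
    have b: "cons_ray i0 \<xi> \<in> tree_boundary p" "cons_ray i \<rho> \<in> tree_boundary p"
      using cons_ray_in_boundary i0 \<xi> i \<rho> R(3) by auto
    have "h \<circ> cons_ray i0 \<xi> = u \<circ> cons_ray i \<rho>"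
      using comp_cons_ray[OF HA[OF h(1)] i0 \<xi>]
        comp_cons_ray[OF UA[OF u(1)] i, of \<rho>] u(2,3) h(2) v(2) R(3) \<rho>
      by (simp add: subset_iff)
    then have "(inv w \<otimes> h) \<circ> cons_ray i0 \<xi> = (inv w \<otimes> u) \<circ> cons_ray i \<rho>"
      using comp_mult[of "inv w" h] comp_mult[of "inv w" u] b w h u UA HA by simp
    moreover have "inv w \<otimes> h = g" using w g UA HA by (simp add: h_def)
    moreover have "inv w \<otimes> u \<in> U"
      using subgroup.m_closed[OF U(1)] subgroup.m_inv_closed[OF U(1)] w u by blast
    ultimately show ?thesis using \<rho> by (metis image_eqI)
  qed
  ultimately show ?thesis unfolding orbits_le_def by (intro exI[of _ ?R] conjI ballI)
qed

lemma orbits_le_self: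
  assumes "subgroup H A" "\<xi> \<in> tree_boundary p"
  shows "orbits_le p H H \<xi> 1"
  unfolding orbits_le_def using assms by (intro exI[of _ "{\<xi>}"]) auto

lemma card_orbits_le:
  assumes H: "subgroup H A" and U: "subgroup U A" "U \<subseteq> H"
    and \<xi>: "\<xi> \<in> tree_boundary p"
    and X: "X = {g \<circ> \<xi> | g. g \<in> H}"
    and le: "orbits_le p H U \<xi> r"
  shows "finite (orbits (A \<lparr>carrier := U\<rparr>) X (path_action X))"
    and "card (orbits (A \<lparr>carrier := U\<rparr>) X (path_action X)) \<le> r"
proof -
  note UA = subgroup.mem_carrier[OF U(1)] and HA = subgroup.mem_carrier[OF H]
  from le obtain R where R: "finite R" "card R \<le> r" "R \<subseteq> tree_boundary p"
     "\<And>g. g \<in> H \<Longrightarrow> \<exists>\<rho> \<in> R. \<exists>u \<in> U. g \<circ> \<xi> = u \<circ> \<rho>"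
    unfolding orbits_le_def by metis
  let ?O = "orbits (A \<lparr>carrier := U\<rparr>) X (path_action X)"
  let ?orb = "\<lambda>\<rho>. {u \<circ> \<rho> | u. u \<in> U}"
  have sub: "?O \<subseteq> ?orb ` R"
  proof
    fix Y assume "Y \<in> ?O"
    then obtain x where x: "x \<in> X" "Y = {path_action X u x | u. u \<in> U}"
      by (auto simp: orbits_def orbit_def)
    have Y: "Y = {u \<circ> x | u. u \<in> U}" using x by (simp add: path_action_def comp_def)
    obtain \<rho> w where w: "\<rho> \<in> R" "w \<in> U" "x = w \<circ> \<rho>" using R(4) x(1) X by blast
    have b: "\<rho> \<in> tree_boundary p" using R w by blast
    have "Y = ?orb \<rho>"
    proof (intro equalityI subsetI)
      fix y assume "y \<in> Y"
      then obtain u where u: "u \<in> U" "y = u \<circ> (w \<circ> \<rho>)" using Y w by auto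
      then have "y = (u \<otimes> w) \<circ> \<rho>" using comp_mult[of u w \<rho>] UA w b by simp
      then show "y \<in> ?orb \<rho>" using subgroup.m_closed[OF U(1)] u w by blast
    next
      fix y assume "y \<in> ?orb \<rho>"
      then obtain u where u: "u \<in> U" "y = u \<circ> \<rho>" by auto
      have "u = (u \<otimes> inv w) \<otimes> w" using UA u w by (simp add: m_assoc)
      then have "y = (u \<otimes> inv w) \<circ> x"
        using comp_mult[of "u \<otimes> inv w" w \<rho>] UA u w b by simp
      then show "y \<in> Y"
        using Y subgroup.m_closed[OF U(1)] subgroup.m_inv_closed[OF U(1)] u w by blast
    qed
    then show "Y \<in> ?orb ` R" using w by blast
  qed
  then show "finite ?O" "card ?O \<le> r"
    using finite_surj[OF R(1) sub] order_trans[OF surj_card_le[OF R(1) sub] R(2)] by simp_all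
qed

end

section \<open>Branching groups\<close>

text \<open>A self-similar group \<open>H\<close> with a normal subgroup \<open>N\<close> such that \<open>N \<times> \<dots> \<times> N \<le> N\<close> (assumption \<open>branch\<close>
  gives the first factor, conjugation by the rotation the others). In \<open>N / (N \<times> \<dots> \<times> N)\<close> every element is
  a power of its \<open>d\<close>-th power for \<open>0 < d < p\<close>, which rules out proper subgroups of index less than \<open>p\<close>. The
  chain \<open>L\<close> climbs from \<open>N\<close> to \<open>H\<close> in \<open>k\<close> steps, each term consisting of sections of elements of the
  previous one: it measures how many levels one has to descend until sections of elements of \<open>N\<close>
  fill the whole group.\<close>

locale branching_group = regular_tree p A for p :: nat and A (structure) +
  fixes H N :: "tree_map set" and L :: "nat \<Rightarrow> tree_map set" and k :: nat
  assumes p_ge_2: "2 \<le> p"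
    and H: "subgroup H A"
    and sect_in_H: "\<lbrakk>f \<in> H; i < p\<rbrakk> \<Longrightarrow> sect p f i \<in> H"
    and rotation_in_H: "rotation p \<in> H"
    and N: "normal_in A H N"
    and branch: "n \<in> N \<Longrightarrow> inject n \<in> N"
    and power: "\<lbrakk>x \<in> N; 0 < d; d < p\<rbrakk> \<Longrightarrow> \<exists>e :: nat. x [^] (d * e) \<otimes> inv x \<in> tuples N"
    and k_pos: "0 < k"
    and L_0: "L 0 = N"
    and L_k: "L k = H"
    and L_normal: "s \<le> k \<Longrightarrow> normal_in A H (L s)"
    and L_Suc: "s < k \<Longrightarrow> L (Suc s) \<subseteq> sect_group (L s) 0"
begin

lemma HA: "f \<in> H \<Longrightarrow> f \<in> carrier A"
  by (rule subgroup.mem_carrier[OF H])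

lemma N_sub: "subgroup N A" and NH: "N \<subseteq> H"
  using N by (auto simp: normal_in_def)

lemma NA: "f \<in> N \<Longrightarrow> f \<in> carrier A"
  by (rule subgroup.mem_carrier[OF N_sub])

lemma branch_at:
  assumes n: "n \<in> N" and i: "i < p"
  shows "tuple p (\<lambda>j. if j = i then n else \<one>) \<in> N"
  using i
proof (induction i)
  case 0
  then show ?case using branch n by (simp add: inject_def)
next
  case (Suc i)
  let ?a = "rotation p" and ?t = "\<lambda>i. tuple p (\<lambda>j. if j = i then n else \<one>)"
  have t: "?t i \<in> carrier A" "root_perm (?t i) j = j" "sect p (?t i) j = (if j = i then n else \<one>)"
    if "j < p" for i j
    using that NA[OF n] by (simp_all add: tuple_closed root_perm_tuple sect_tuple)
  have a: "?a \<in> carrier A" using rotation_in_H HA by blast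
  have conj: "?a \<otimes> ?t i \<otimes> inv ?a \<in> N"
    using normal_in_conj[OF N rotation_in_H] Suc by simp
  have "?a \<otimes> ?t i = ?t (Suc i) \<otimes> ?a"
  proof (rule aut_eqI)
    fix j assume j: "j < p"
    have lt: "(j + 1) mod p < p" using j by simp
    have iff: "(j + 1) mod p = Suc i \<longleftrightarrow> j = i" using j Suc.prems by (auto simp: mod_Suc)
    show "root_perm (?a \<otimes> ?t i) j = root_perm (?t (Suc i) \<otimes> ?a) j"
      using a t j lt by (simp add: root_perm_rotation)
    show "sect p (?a \<otimes> ?t i) j = sect p (?t (Suc i) \<otimes> ?a) j"
      using a t j lt iff NA[OF n] by (simp add: root_perm_rotation sect_rotation)
  qed (use a t[OF Suc.prems] in auto)
  then have "?a \<otimes> ?t i \<otimes> inv ?a = ?t (Suc i)"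
    using a t(1)[OF Suc.prems] by (simp add: m_assoc)
  then show ?case using conj by simp
qed

lemma tuple_in_N:
  assumes s: "\<And>i. i < p \<Longrightarrow> s i \<in> N"
  shows "tuple p s \<in> N"
proof -
  let ?t = "\<lambda>r. tuple p (\<lambda>i. if i < r then s i else \<one>)"
  have sA: "s i \<in> carrier A" if "i < p" for i using s[OF that] NA by blast
  have "?t r \<in> N" if "r \<le> p" for r
    using that
  proof (induction r)
    case 0
    have "?t 0 = \<one>" by (rule aut_eqI) (auto simp: tuple_closed root_perm_tuple sect_tuple)
    then show ?case using subgroup.one_closed[OF N_sub] by simp
  next
    case (Suc r)
    let ?d = "tuple p (\<lambda>i. if i = r then s r else \<one>)"
    have d: "?d \<in> carrier A" using Suc.prems sA by (auto intro!: tuple_closed)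
    have A: "?t r' \<in> carrier A" if "r' \<le> p" for r' using sA that by (auto intro!: tuple_closed)
    have rd: "root_perm ?d j = j" "sect p ?d j = (if j = r then s r else \<one>)" if "j < p" for j
      using Suc.prems sA that by (auto simp: root_perm_tuple sect_tuple)
    have rt: "root_perm (?t r') j = j" "sect p (?t r') j = (if j < r' then s j else \<one>)"
      if "j < p" "r' \<le> p" for j r'
      using Suc.prems sA that by (auto simp: root_perm_tuple sect_tuple)
    have "?t (Suc r) = ?t r \<otimes> ?d"
    proof (rule aut_eqI)
      fix j assume j: "j < p"
      show "root_perm (?t (Suc r)) j = root_perm (?t r \<otimes> ?d) j"
        using Suc.prems A d j rd rt by simp
      show "sect p (?t (Suc r)) j = sect p (?t r \<otimes> ?d) j"
        using Suc.prems A d j rd rt sA by (cases "j < r"; cases "j = r") simp_all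
    qed (use A d Suc.prems in auto)
    moreover have "?d \<in> N" using branch_at[OF s[of r], of r] Suc.prems by simp
    ultimately show ?case using Suc subgroup.m_closed[OF N_sub] by simp
  qed
  from this[of p] have "?t p \<in> N" by simp
  moreover have "?t p = tuple p s"
    by (rule aut_eqI) (auto simp: tuple_closed root_perm_tuple sect_tuple sA)
  ultimately show ?thesis by simp
qed

lemma tuples_subset: "tuples N \<subseteq> N"
proof
  fix f assume f: "f \<in> tuples N"
  then have fA: "f \<in> carrier A" and r: "\<And>i. i < p \<Longrightarrow> root_perm f i = i"
    and s: "\<And>i. i < p \<Longrightarrow> sect p f i \<in> N" by (simp_all add: tuples_def)
  have "tuple p (sect p f) \<in> N" by (rule tuple_in_N[OF s])
  moreover have "tuple p (sect p f) = f"
    by (rule aut_eqI) (simp_all add: fA r tuple_closed root_perm_tuple sect_tuple)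
  ultimately show "f \<in> N" by simp
qed

lemma normal_tuples: "normal_in A H (tuples N)"
  unfolding normal_in_def
proof (intro conjI ballI)
  show "subgroup (tuples N) A" by (rule subgroup_tuples[OF N_sub])
  show "tuples N \<subseteq> H" using tuples_subset NH by blast
  fix h n assume h: "h \<in> H" and n: "n \<in> tuples N"
  have nA: "n \<in> carrier A" and hA: "h \<in> carrier A" using n h HA by (auto simp: tuples_def)
  have "root_perm (h \<otimes> n \<otimes> inv h) i = i \<and> sect p (h \<otimes> n \<otimes> inv h) i \<in> N" if i: "i < p" for i
  proof -
    let ?j = "root_perm (inv h) i"
    have j: "?j < p" "root_perm n ?j = ?j" "sect p n ?j \<in> N" "root_perm h ?j = i"
      using hA i n by (auto simp: tuples_def)
    have "sect p (inv h) i = inv (sect p h ?j)" using sect_inv[OF hA j(1,4)] .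
    then have "sect p (h \<otimes> n \<otimes> inv h) i = sect p h ?j \<otimes> sect p n ?j \<otimes> inv (sect p h ?j)"
      using hA nA i j by simp
    then show ?thesis
      using normal_in_conj[OF N sect_in_H[OF h j(1)] j(3)] hA nA i j by simp
  qed
  then show "h \<otimes> n \<otimes> inv h \<in> tuples N" using hA nA by (simp add: tuples_def)
qed

lemma L_Suc_at:
  assumes s: "s < k" and i: "i < p" and g: "g \<in> L (Suc s)"
  shows "\<exists>x \<in> L s. root_perm x i = i \<and> sect p x i = g"
  using i
proof (induction i)
  case 0
  then show ?case using L_Suc[OF s] g by (auto simp: sect_group_def)
next
  case (Suc i)
  then obtain x where x: "x \<in> L s" "root_perm x i = i" "sect p x i = g" by auto
  have "x \<in> carrier A" using L_normal[of s] s x HA by (auto simp: normal_in_def)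
  then show ?case
    using rotation_conj[of x i] Suc.prems x normal_in_conj[OF L_normal rotation_in_H x(1)] s
    by (intro bexI[of _ "rotation p \<otimes> x \<otimes> inv (rotation p)"]) auto
qed

text \<open>The index of \<open>N \<inter> U\<close> in \<open>N\<close>, counted as the number of cosets of \<open>U\<close> that meet \<open>N\<close>.\<close>

definition rel_index :: "tree_map set \<Rightarrow> nat" where
  "rel_index U = card ((\<lambda>x. U #> x) ` N)"

text \<open>The product \<open>N \<times> \<dots> \<times> N\<close> meets at least \<open>\<Prod>i. rel_index (sect_group U i)\<close> cosets of \<open>U\<close>: choose coset
  representatives independently in each coordinate. Multiplying these tuples by elements \<open>t\<close> that
  are inequivalent modulo \<open>U (N \<times> \<dots> \<times> N)\<close> keeps the cosets apart.\<close>

lemma rel_index_product: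
  assumes U: "subgroup U A" "U \<subseteq> H" and fin: "finite ((\<lambda>x. U #> x) ` N)"
    and T: "T \<subseteq> N" and sep: "\<And>t t'. \<lbrakk>t \<in> T; t' \<in> T; t \<otimes> inv t' \<in> U <#> tuples N\<rbrakk> \<Longrightarrow> t = t'"
  shows "i < p \<Longrightarrow> finite ((\<lambda>x. sect_group U i #> x) ` N)"
    and "card T * (\<Prod>i<p. rel_index (sect_group U i)) \<le> rel_index U"
proof -
  note UA = subgroup.mem_carrier[OF U(1)]
  have tA: "t \<in> carrier A" if "t \<in> T" for t using that T NA by blast
  have tup: "tuple p s \<in> tuples N" if "\<And>i. i < p \<Longrightarrow> s i \<in> N" for s
    using that NA by (intro tuple_in_tuples) auto
  have tuplesA: "f \<in> carrier A" if "f \<in> tuples N" for f using that by (simp add: tuples_def)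
  define C where "C i = (\<lambda>x. sect_group U i #> x) ` N" for i
  define rep where "rep i c = (SOME x. x \<in> N \<and> sect_group U i #> x = c)" for i c
  have rep: "rep i c \<in> N \<and> sect_group U i #> rep i c = c" if "c \<in> C i" for i c
  proof -
    have "\<exists>x. x \<in> N \<and> sect_group U i #> x = c" using that by (auto simp: C_def)
    then show ?thesis unfolding rep_def by (rule someI_ex)
  qed
  have coset_sect: "sect_group U i #> s i = sect_group U i #> s' i"
    if s: "\<And>i. i < p \<Longrightarrow> s i \<in> N" and s': "\<And>i. i < p \<Longrightarrow> s' i \<in> N" and i: "i < p"
      and u: "tuple p s \<otimes> inv (tuple p s') \<in> U" for s s' i
  proof -
    have A: "s j \<in> carrier A" "s' j \<in> carrier A" if "j < p" for j using s s' NA that by auto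
    let ?u = "tuple p s \<otimes> inv (tuple p s')"
    have "root_perm (inv (tuple p s')) i = i"
      using A i by (intro root_perm_inv) (auto simp: tuple_closed root_perm_tuple)
    moreover have "sect p (inv (tuple p s')) i = inv (s' i)"
      using sect_inv[of "tuple p s'" i i] A i by (simp add: tuple_closed root_perm_tuple sect_tuple)
    ultimately have "root_perm ?u i = i" "sect p ?u i = s i \<otimes> inv (s' i)"
      using A i by (simp_all add: tuple_closed root_perm_tuple sect_tuple)
    then have "s i \<otimes> inv (s' i) \<in> sect_group U i" using u by (intro sect_groupI)
    then show ?thesis using rcos_eq_iff[OF subgroup_sect_group[OF U(1) i]] A i by simp
  qed
  \<comment> \<open>A pair of some \<open>t \<in> T\<close> and a choice of one coset of each section group determines a coset of \<open>U\<close>.\<close>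
  define \<Phi> where "\<Phi> = (\<lambda>(t, c). U #> (tuple p (\<lambda>i. rep i (c i)) \<otimes> t))"
  let ?D = "T \<times> (\<Pi>\<^sub>E i\<in>{..<p}. C i)"
  have inj: "inj_on \<Phi> ?D"
  proof (rule inj_onI, clarify)
    fix t c t' c'
    assume t: "t \<in> T" "t' \<in> T" and c: "c \<in> (\<Pi>\<^sub>E i\<in>{..<p}. C i)" "c' \<in> (\<Pi>\<^sub>E i\<in>{..<p}. C i)"
      and eq: "\<Phi> (t, c) = \<Phi> (t', c')"
    let ?s = "\<lambda>i. rep i (c i)" and ?s' = "\<lambda>i. rep i (c' i)"
    have s: "?s i \<in> N" "?s' i \<in> N" if "i < p" for i using rep c that by (auto simp: PiE_iff)
    have mem: "tuple p ?s \<in> tuples N" "tuple p ?s' \<in> tuples N" using tup s by auto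
    have A: "tuple p ?s \<in> carrier A" "tuple p ?s' \<in> carrier A" "t \<in> carrier A" "t' \<in> carrier A"
      using mem t tuplesA tA by auto
    have u: "tuple p ?s \<otimes> t \<otimes> inv (tuple p ?s' \<otimes> t') \<in> U" (is "?u \<in> U")
      using eq rcos_eq_iff[OF U(1), of "tuple p ?s \<otimes> t" "tuple p ?s' \<otimes> t'"] A by (simp add: \<Phi>_def)
    have sub: "subgroup (U <#> tuples N) A" by (rule subgroup_set_mult[OF U normal_tuples H])
    have "f \<in> U <#> tuples N" if "f \<in> tuples N" for f
      using set_multI[OF subgroup.one_closed[OF U(1)] that] tuplesA[OF that] by simp
    moreover have "?u \<in> U <#> tuples N"
      using set_multI[OF u subgroup.one_closed[OF subgroup_tuples[OF N_sub]]] UA[OF u] by simp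
    ultimately have "inv (tuple p ?s) \<otimes> ?u \<otimes> tuple p ?s' \<in> U <#> tuples N"
      using mem subgroup.m_closed[OF sub subgroup.m_closed[OF sub subgroup.m_inv_closed[OF sub]]]
      by blast
    also have "inv (tuple p ?s) \<otimes> ?u \<otimes> tuple p ?s' = t \<otimes> inv t'"
      using A by (simp add: m_assoc inv_mult_group)
    finally have "t \<otimes> inv t' \<in> U <#> tuples N" .
    then have tt': "t = t'" using sep t by blast
    then have "tuple p ?s \<otimes> inv (tuple p ?s') \<in> U"
      using u A by (simp add: m_assoc inv_mult_group)
    then have "sect_group U i #> ?s i = sect_group U i #> ?s' i" if "i < p" for i
      using coset_sect[of ?s ?s' i] s that by auto
    moreover have "sect_group U i #> ?s i = c i" "sect_group U i #> ?s' i = c' i" if "i < p" for i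
      using rep[of "c i" i] rep[of "c' i" i] PiE_mem[OF c(1), of i] PiE_mem[OF c(2), of i] that
      by simp_all
    ultimately have "c i = c' i" if "i < p" for i using that by metis
    then have "c = c'" using PiE_ext[OF c] by simp
    with tt' show "t = t' \<and> c = c'" by simp
  qed
  have "\<Phi> ` ?D \<subseteq> (\<lambda>x. U #> x) ` N"
  proof (rule image_subsetI)
    fix x assume "x \<in> ?D"
    then obtain t c where tc: "x = (t, c)" "t \<in> T" "c \<in> (\<Pi>\<^sub>E i\<in>{..<p}. C i)" by auto
    then have "tuple p (\<lambda>i. rep i (c i)) \<in> N"
      using rep by (intro tuple_in_N) (auto simp: PiE_iff)
    then have "tuple p (\<lambda>i. rep i (c i)) \<otimes> t \<in> N"
      using T tc subgroup.m_closed[OF N_sub] by blast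
    then show "\<Phi> x \<in> (\<lambda>x. U #> x) ` N" using tc by (simp add: \<Phi>_def)
  qed
  from card_inj_on_le[OF inj this fin] 
  show "card T * (\<Prod>i<p. rel_index (sect_group U i)) \<le> rel_index U"
    by (simp add: card_cartesian_product card_PiE rel_index_def C_def)
  \<comment> \<open>Finiteness is needed separately: \<open>card\<close> is \<open>0\<close> on infinite sets.\<close>
  show "finite ((\<lambda>x. sect_group U i #> x) ` N)" if i: "i < p"
  proof -
    let ?\<delta> = "\<lambda>x. tuple p (\<lambda>j. if j = i then x else \<one>)"
    have "inj_on (\<lambda>c. U #> ?\<delta> (rep i c)) (C i)"
    proof (rule inj_onI)
      fix c c' assume c: "c \<in> C i" "c' \<in> C i" and eq: "U #> ?\<delta> (rep i c) = U #> ?\<delta> (rep i c')"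
      have "?\<delta> (rep i c) \<in> carrier A" "?\<delta> (rep i c') \<in> carrier A"
        using branch_at[OF _ i] rep[OF c(1)] rep[OF c(2)] NA by blast+
      then have "?\<delta> (rep i c) \<otimes> inv (?\<delta> (rep i c')) \<in> U" using eq rcos_eq_iff[OF U(1)] by blast
      then have "sect_group U i #> rep i c = sect_group U i #> rep i c'"
        using coset_sect[of "\<lambda>j. if j = i then rep i c else \<one>" "\<lambda>j. if j = i then rep i c' else \<one>" i]
          rep[OF c(1)] rep[OF c(2)] i subgroup.one_closed[OF N_sub] by simp
      then show "c = c'" using rep[OF c(1)] rep[OF c(2)] by simp
    qed
    moreover have "(\<lambda>c. U #> ?\<delta> (rep i c)) ` C i \<subseteq> (\<lambda>x. U #> x) ` N"
      using branch_at[OF _ i] rep by blast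
    ultimately show ?thesis using fin unfolding C_def by (metis (no_types, lifting) inj_on_finite)
  qed
qed

lemma rel_index_pos: "finite ((\<lambda>x. U #> x) ` N) \<Longrightarrow> 0 < rel_index U"
  using subgroup.one_closed[OF N_sub] by (auto simp: rel_index_def card_gt_0_iff)

lemma rel_index_le:
  assumes fin: "finite (rcosets\<^bsub>A\<lparr>carrier := H\<rparr>\<^esub> U)"
  shows "finite ((\<lambda>x. U #> x) ` N)"
    and "rel_index U \<le> card (rcosets\<^bsub>A\<lparr>carrier := H\<rparr>\<^esub> U)"
proof -
  have "(\<lambda>x. U #> x) ` N \<subseteq> rcosets\<^bsub>A\<lparr>carrier := H\<rparr>\<^esub> U"
    using NH by (auto simp: RCOSETS_def r_coset_def)
  with fin show "finite ((\<lambda>x. U #> x) ` N)" "rel_index U \<le> card (rcosets\<^bsub>A\<lparr>carrier := H\<rparr>\<^esub> U)"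
    unfolding rel_index_def by (auto intro: finite_subset card_mono)
qed

lemma sect_group_subset: "\<lbrakk>U \<subseteq> H; i < p\<rbrakk> \<Longrightarrow> sect_group U i \<subseteq> H"
  using sect_in_H by (auto simp: sect_group_def)

text \<open>If \<open>U (N \<times> \<dots> \<times> N)\<close> misses some \<open>y \<in> N\<close>, the powers \<open>y^0, \<dots>, y^(p - 1)\<close> are inequivalent modulo it,
  and \<open>rel_index_product\<close> gains a factor \<open>p\<close>.\<close>

lemma rel_index_drop:
  assumes U: "subgroup U A" "U \<subseteq> H" and fin: "finite ((\<lambda>x. U #> x) ` N)"
    and not: "\<not> N \<subseteq> U <#> tuples N"
  shows "p * (\<Prod>i<p. rel_index (sect_group U i)) \<le> rel_index U"
proof -
  let ?Q = "U <#> tuples N"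
  have sub: "subgroup ?Q A" by (rule subgroup_set_mult[OF U normal_tuples H])
  obtain y where y: "y \<in> N" "y \<notin> ?Q" using not by blast
  have yA: "y \<in> carrier A" using y NA by blast
  have y_pow: "y [^] d \<notin> ?Q" if d: "0 < d" "d < p" for d :: nat
  proof
    assume yd: "y [^] d \<in> ?Q"
    obtain e :: nat where e: "y [^] (d * e) \<otimes> inv y \<in> tuples N" using power[OF y(1) d] by blast
    have pow: "z [^] e \<in> ?Q" if "z \<in> ?Q" for z
      using that by (induction e) (auto intro: subgroup.m_closed[OF sub] subgroup.one_closed[OF sub])
    have "y [^] (d * e) \<in> ?Q" using pow[OF yd] yA by (simp add: nat_pow_pow)
    moreover have "y [^] (d * e) \<otimes> inv y \<in> ?Q"
      using set_multI[OF subgroup.one_closed[OF U(1)] e] yA by simp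
    ultimately have "inv (y [^] (d * e) \<otimes> inv y) \<otimes> y [^] (d * e) \<in> ?Q"
      using subgroup.m_closed[OF sub subgroup.m_inv_closed[OF sub]] by blast
    then show False using y(2) yA by (simp add: inv_mult_group m_assoc)
  qed
  let ?T = "(\<lambda>d. y [^] d) ` {..<p}"
  have diff: "y [^] i \<otimes> inv (y [^] j) = y [^] (i - j)" if "j \<le> i" for i j :: nat
  proof -
    have "y [^] i = y [^] (i - j) \<otimes> y [^] j" using that yA by (simp add: nat_pow_mult)
    then show ?thesis using yA by (simp add: m_assoc)
  qed
  have sep: "i = j" if ij: "i < p" "j < p" "y [^] i \<otimes> inv (y [^] j) \<in> ?Q" for i j :: nat
  proof (rule ccontr)
    assume "i \<noteq> j"
    then consider "j < i" | "i < j" by linarith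
    then show False
    proof cases
      case 1
      then show False using diff[of j i] y_pow[of "i - j"] ij by simp
    next
      case 2
      have "inv (y [^] i \<otimes> inv (y [^] j)) \<in> ?Q" using subgroup.m_inv_closed[OF sub ij(3)] .
      then have "y [^] j \<otimes> inv (y [^] i) \<in> ?Q" using yA by (simp add: inv_mult_group)
      then show False using diff[of i j] y_pow[of "j - i"] ij 2 by simp
    qed
  qed
  have "inj_on (\<lambda>d. y [^] d) {..<p}"
  proof (rule inj_onI)
    fix i j assume ij: "i \<in> {..<p}" "j \<in> {..<p}" "y [^] i = y [^] j"
    then have "y [^] i \<otimes> inv (y [^] j) \<in> ?Q" using yA subgroup.one_closed[OF sub] by simp
    then show "i = j" using sep ij by simp
  qed
  then have "card ?T = p" by (simp add: card_image)
  moreover have "?T \<subseteq> N"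
  proof (rule image_subsetI)
    show "y [^] d \<in> N" for d :: nat
      by (induction d) (auto intro: subgroup.m_closed[OF N_sub] subgroup.one_closed[OF N_sub] y(1))
  qed
  ultimately show ?thesis using rel_index_product(2)[OF U fin, of ?T] sep by fastforce
qed

text \<open>The case \<open>T = {\<one>}\<close> of \<open>rel_index_product\<close>, which holds for every \<open>U\<close>.\<close>

lemma rel_index_step:
  assumes U: "subgroup U A" "U \<subseteq> H" and fin: "finite ((\<lambda>x. U #> x) ` N)"
  shows "i < p \<Longrightarrow> finite ((\<lambda>x. sect_group U i #> x) ` N)"
    and "(\<Prod>i<p. rel_index (sect_group U i)) \<le> rel_index U"
  using rel_index_product[OF U fin, of "{\<one>}"] subgroup.one_closed[OF N_sub] by auto

lemma transitive_level_1:
  assumes "j < p" "i < p"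
  shows "\<exists>h \<in> H. root_perm h j = i"
proof -
  have a: "rotation p \<in> carrier A" using rotation_in_H HA by blast
  have pow: "root_perm (rotation p [^] n) j = (j + n) mod p \<and> rotation p [^] n \<in> H" for n :: nat
  proof (induction n)
    case (Suc n)
    have "(j + n) mod p < p" using assms by simp
    have "rotation p [^] Suc n = rotation p \<otimes> rotation p [^] n"
      using a nat_pow_Suc2 by blast
    then show ?case
      using Suc a assms \<open>(j + n) mod p < p\<close> subgroup.m_closed[OF H rotation_in_H]
      by (simp add: root_perm_rotation mod_simps)
  qed (use assms subgroup.one_closed[OF H] in simp)
  have "(j + (p - j + i)) mod p = i" using assms by simp
  then show ?thesis using pow[of "p - j + i"] by metis
qed

lemma sect_in_set_mult:
  assumes U: "U \<subseteq> carrier A" and x: "x \<in> U <#> tuples N" and i: "i < p" "root_perm x i = i"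
  shows "sect p x i \<in> sect_group U i <#> N"
proof -
  obtain u m where um: "u \<in> U" "m \<in> tuples N" "x = u \<otimes> m" using x by (auto simp: set_mult_def)
  have m: "m \<in> carrier A" "root_perm m i = i" "sect p m i \<in> N" using um(2) i by (auto simp: tuples_def)
  have "u \<in> carrier A" using U um by blast
  then have "root_perm u i = i" "sect p x i = sect p u i \<otimes> sect p m i" using um m i by simp_all
  then show ?thesis using um(1) m by (auto intro!: set_multI sect_groupI)
qed

text \<open>The stage \<open>s\<close> records how much of \<open>H\<close> is known to be covered by \<open>U\<close> modulo \<open>N\<close>. Passing to level 1, either
  the relative index loses a factor \<open>p\<close> and all \<open>p\<close> subtrees start again at stage \<open>0\<close>, or they all
  reach stage \<open>s + 1\<close>. At stage \<open>k\<close> without a loss \<open>U\<close> is transitive on level 1 and a single subtree counts.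
  With \<open>C = p^(k + 1) - 1\<close> the summand \<open>C\<close> that a loss takes off the logarithmic term pays for \<open>p\<close> new
  subtrees of cost \<open>p^k\<close> each, up to the remaining \<open>1 \<le> p^(k - s)\<close>.\<close>

theorem orbits_bound:
  assumes "subgroup U A" "U \<subseteq> H" "finite ((\<lambda>x. U #> x) ` N)"
    and "s \<le> k" "L s \<subseteq> U <#> N" "\<xi> \<in> tree_boundary p"
  shows "\<exists>r. orbits_le p H U \<xi> r \<and>
    real r \<le> (real p ^ (k + 1) - 1) * log p (rel_index U) + real p ^ (k - s)"
  using assms
proof (induction "rel_index U * (k + 1) + (k - s)" arbitrary: U s \<xi> rule: less_induct)
  case less
  \<comment> \<open>As \<open>k - s < k + 1\<close>, the measure orders the pairs \<open>(rel_index U, k - s)\<close> lexicographically.\<close>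
  note U = less.prems(1,2) and fin = less.prems(3) and s = less.prems(4) and Ls = less.prems(5)
  define C where "C = real p ^ (k + 1) - 1"
  have p1: "real p > 1" using p_ge_2 by simp
  have C: "C \<ge> 0" unfolding C_def using p1 one_le_power[of "real p" "k + 1"] by linarith
  obtain i0 \<zeta> where i0: "i0 < p" and \<zeta>: "\<zeta> \<in> tree_boundary p" and \<xi>: "\<xi> = cons_ray i0 \<zeta>"
    using boundary_cases[OF less.prems(6)] .
  note UA = subgroup.mem_carrier[OF U(1)]
  let ?V = "sect_group U"
  have V: "subgroup (?V i) A" "?V i \<subseteq> H" "finite ((\<lambda>x. ?V i #> x) ` N)" if "i < p" for i
    using subgroup_sect_group[OF U(1)] sect_group_subset[OF U(2)] rel_index_step(1)[OF U fin] that by auto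
  have Vpos: "0 < rel_index (?V i)" if "i < p" for i using rel_index_pos V that by blast
  have upos: "0 < rel_index U" using rel_index_pos fin .
  have prod_pos: "0 < (\<Prod>i<p. rel_index (?V i))" using Vpos by (simp add: prod_pos)
  have V_le: "rel_index (?V i) \<le> (\<Prod>i<p. rel_index (?V i))" if "i < p" for i
    using that prod_pos by (intro dvd_imp_le dvd_prodI) auto
  have sum_log: "(\<Sum>i<p. log p (rel_index (?V i))) = log p (\<Prod>i<p. rel_index (?V i))"
    using ln_prod[of "{..<p}" "\<lambda>i. real (rel_index (?V i))"] Vpos
    by (simp add: log_def sum_divide_distrib[symmetric])
  have children: "\<exists>r. orbits_le p H U \<xi> r \<and>
      real r \<le> C * log p (\<Prod>i<p. rel_index (?V i)) + real p ^ (k - t + 1)"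
    if t: "t \<le> k" and L: "\<And>i. i < p \<Longrightarrow> L t \<subseteq> ?V i <#> N"
      and smaller: "\<And>i. i < p \<Longrightarrow> rel_index (?V i) * (k + 1) + (k - t) < rel_index U * (k + 1) + (k - s)" for t
  proof -
    have "\<exists>r. orbits_le p H (?V i) \<zeta> r \<and> real r \<le> C * log p (rel_index (?V i)) + real p ^ (k - t)"
      if i: "i < p" for i
      using less.hyps[OF smaller[OF i] V[OF i] t L[OF i] \<zeta>] by (simp add: C_def)
    then obtain r where r: "\<And>i. i < p \<Longrightarrow> orbits_le p H (?V i) \<zeta> (r i)"
      "\<And>i. i < p \<Longrightarrow> real (r i) \<le> C * log p (rel_index (?V i)) + real p ^ (k - t)"
      by metis
    have "orbits_le p H U \<xi> (\<Sum>i<p. r i)"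
      unfolding \<xi> using orbits_le_sum[OF _ _ sect_in_H i0 \<zeta> r(1)] UA HA by blast
    moreover have "real (\<Sum>i<p. r i) \<le> (\<Sum>i<p. C * log p (rel_index (?V i)) + real p ^ (k - t))"
      unfolding of_nat_sum by (rule sum_mono) (use r(2) in simp)
    moreover have "\<dots> = C * log p (\<Prod>i<p. rel_index (?V i)) + real p ^ (k - t + 1)"
      unfolding sum_log[symmetric] by (simp add: sum.distrib sum_distrib_left)
    ultimately show ?thesis by (metis (no_types, lifting))
  qed
  have log_pos: "0 \<le> log p (rel_index U)" using upos p1 by simp
  have "\<exists>r. orbits_le p H U \<xi> r \<and> real r \<le> C * log p (rel_index U) + real p ^ (k - s)"
  proof (cases "N \<subseteq> U <#> tuples N")
    case False
    \<comment> \<open>A factor \<open>p\<close> is lost; every subtree starts again at stage \<open>0\<close>.\<close>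
    have drop: "p * (\<Prod>i<p. rel_index (?V i)) \<le> rel_index U" by (rule rel_index_drop[OF U fin False])
    have "\<exists>r. orbits_le p H U \<xi> r \<and>
        real r \<le> C * log p (\<Prod>i<p. rel_index (?V i)) + real p ^ (k - 0 + 1)"
    proof (rule children)
      fix i assume i: "i < p"
      show "L 0 \<subseteq> ?V i <#> N"
        using set_multI[OF subgroup.one_closed[OF V(1)[OF i]]] NA by (fastforce simp: L_0)
      have "2 * rel_index (?V i) \<le> rel_index U" using mult_le_mono[OF p_ge_2 V_le[OF i]] drop by linarith
      then have "rel_index (?V i) + 1 \<le> rel_index U" using Vpos[OF i] by linarith
      from mult_le_mono1[OF this, of "k + 1"]
      show "rel_index (?V i) * (k + 1) + (k - 0) < rel_index U * (k + 1) + (k - s)"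
        by (simp add: algebra_simps)
    qed simp
    then obtain r where r: "orbits_le p H U \<xi> r"
      "real r \<le> C * log p (\<Prod>i<p. rel_index (?V i)) + real p ^ (k + 1)" by auto
    have "log p (p * (\<Prod>i<p. rel_index (?V i))) \<le> log p (rel_index U)"
      using drop prod_pos upos p1 by (intro log_mono) (auto simp del: of_nat_prod of_nat_mult)
    then have "log p (\<Prod>i<p. rel_index (?V i)) \<le> log p (rel_index U) - 1"
      using prod_pos p1 log_mult[of p "\<Prod>i<p. rel_index (?V i)" p] by (simp add: log_mult del: of_nat_prod)
    from mult_left_mono[OF this C] 
    have "C * log p (\<Prod>i<p. rel_index (?V i)) + real p ^ (k + 1) \<le> C * log p (rel_index U) + 1"
      by (simp add: C_def algebra_simps)
    moreover have "1 \<le> real p ^ (k - s)" using p1 by simp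
    ultimately show ?thesis using r by (intro exI[of _ r]) auto
  next
    case True
    have sub: "subgroup (U <#> tuples N) A" by (rule subgroup_set_mult[OF U normal_tuples H])
    have U_in: "U \<subseteq> U <#> tuples N"
      using set_multI[OF _ subgroup.one_closed[OF subgroup_tuples[OF N_sub]]] UA by fastforce
    have L_tuples: "L s \<subseteq> U <#> tuples N"
    proof
      fix x assume "x \<in> L s"
      then obtain u n where "u \<in> U" "n \<in> N" "x = u \<otimes> n" using Ls by (auto simp: set_mult_def)
      then show "x \<in> U <#> tuples N" using subgroup.m_closed[OF sub] U_in True by blast
    qed
    have prod_le: "(\<Prod>i<p. rel_index (?V i)) \<le> rel_index U" by (rule rel_index_step(2)[OF U fin])
    have V_le_U: "rel_index (?V i) \<le> rel_index U" if "i < p" for i using V_le[OF that] prod_le by simp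
    show ?thesis
    proof (cases "s = k")
      case False
      with s have sk: "s < k" by simp
      \<comment> \<open>The elements of \<open>L s\<close> agree with elements of \<open>U\<close> up to \<open>N \<times> \<dots> \<times> N\<close>, so their sections, which
        fill \<open>L (Suc s)\<close>, agree with elements of the section groups up to \<open>N\<close>.\<close>
      have "\<exists>r. orbits_le p H U \<xi> r \<and>
          real r \<le> C * log p (\<Prod>i<p. rel_index (?V i)) + real p ^ (k - Suc s + 1)"
      proof (rule children)
        fix i assume i: "i < p"
        show "L (Suc s) \<subseteq> ?V i <#> N"
        proof
          fix g assume "g \<in> L (Suc s)"
          then obtain x where "x \<in> L s" "root_perm x i = i" "sect p x i = g"
            using L_Suc_at[OF sk i] by blast
          then show "g \<in> ?V i <#> N" using sect_in_set_mult[of U x i] L_tuples i UA by blast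
        qed
        show "rel_index (?V i) * (k + 1) + (k - Suc s) < rel_index U * (k + 1) + (k - s)"
          using mult_le_mono1[OF V_le_U[OF i], of "k + 1"] sk by linarith
      qed (use sk in simp)
      then obtain r where r: "orbits_le p H U \<xi> r"
        "real r \<le> C * log p (\<Prod>i<p. rel_index (?V i)) + real p ^ (k - s)"
        using sk by (auto simp: Suc_diff_Suc)
      have "log p (\<Prod>i<p. rel_index (?V i)) \<le> log p (rel_index U)"
        using prod_le prod_pos upos p1 by (intro log_mono) (auto simp del: of_nat_prod)
      from mult_left_mono[OF this C] show ?thesis using r by (intro exI[of _ r]) auto
    next
      case s_eq: True
      have H_sub: "H \<subseteq> U <#> tuples N" using L_tuples L_k s_eq by simp
      show ?thesis
      proof (cases "rel_index U = 1")
        case True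
        then obtain c where c: "(\<lambda>x. U #> x) ` N = {c}" unfolding rel_index_def by (rule card_1_singletonE)
        have "n \<in> U" if "n \<in> N" for n
        proof -
          have "U #> n = U #> \<one>" using c that subgroup.one_closed[OF N_sub] by blast
          then show ?thesis using rcos_eq_iff[OF U(1) NA[OF that] one_closed] NA[OF that] by simp
        qed
        then have "H \<subseteq> U"
          using H_sub tuples_subset subgroup.m_closed[OF U(1)] by (fastforce simp: set_mult_def)
        then have "U = H" using U(2) by blast
        then have "orbits_le p H U \<xi> 1" using orbits_le_self[OF H less.prems(6)] by simp
        then show ?thesis using C log_pos s_eq by (intro exI[of _ 1]) simp
      next
        case False
        \<comment> \<open>The stage can no longer increase, but as the product of the \<open>p \<ge> 2\<close> relative indices is
          bounded by \<open>rel_index U > 1\<close>, one of them is smaller; by transitivity that subtree suffices.\<close>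
        have "\<exists>i<p. rel_index (?V i) < rel_index U"
        proof (rule ccontr)
          assume "\<not> (\<exists>i<p. rel_index (?V i) < rel_index U)"
          then have ge: "rel_index U \<le> rel_index (?V i)" if "i < p" for i
            using that leI by blast
          have "(\<Prod>i<p. rel_index U) \<le> (\<Prod>i<p. rel_index (?V i))" by (intro prod_mono) (use ge in auto)
          then have "rel_index U ^ p \<le> rel_index U ^ 1" using prod_le by simp
          moreover have "1 < rel_index U" using False upos by linarith
          ultimately have "p \<le> 1" using power_le_imp_le_exp by blast
          then show False using p_ge_2 by simp
        qed
        then obtain i where i: "i < p" "rel_index (?V i) < rel_index U" by blast
        have "H \<subseteq> ?V i <#> N"
        proof
          fix g assume "g \<in> H"
          then have "g \<in> L (Suc (k - 1))" using L_k k_pos by simp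
          then obtain x where x: "x \<in> L (k - 1)" "root_perm x i = i" "sect p x i = g"
            using L_Suc_at[of "k - 1" i g] k_pos i by auto
          have "x \<in> H" using L_normal[of "k - 1"] x by (auto simp: normal_in_def)
          then show "g \<in> ?V i <#> N" using sect_in_set_mult[of U x i] H_sub x i UA by blast
        qed
        then have LV: "L s \<subseteq> ?V i <#> N" using s_eq L_k by simp
        have "rel_index (?V i) * (k + 1) + (k - s) < rel_index U * (k + 1) + (k - s)"
          using mult_less_mono1[OF i(2), of "k + 1"] by simp
        from less.hyps[OF this V[OF i(1)] s LV \<zeta>]
        obtain r where r: "orbits_le p H (?V i) \<zeta> r"
          "real r \<le> C * log p (rel_index (?V i)) + real p ^ (k - s)" by (auto simp: C_def)
        have "\<exists>u \<in> U. root_perm u j = i" if j: "j < p" for j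
        proof -
          obtain h where h: "h \<in> H" "root_perm h j = i" using transitive_level_1[OF j i(1)] by blast
          then obtain u m where um: "u \<in> U" "m \<in> tuples N" "h = u \<otimes> m"
            using H_sub by (auto simp: set_mult_def)
          then show ?thesis using h j UA by (intro bexI[of _ u]) (auto simp: tuples_def)
        qed
        then have "orbits_le p H U \<xi> r"
          unfolding \<xi> using orbits_le_transitive[OF U H sect_in_H i0 \<zeta> i(1) _ r(1)] by blast
        moreover have "log p (rel_index (?V i)) \<le> log p (rel_index U)"
          using i Vpos[OF i(1)] p1 by (intro log_mono) auto
        from mult_left_mono[OF this C] have "real r \<le> C * log p (rel_index U) + real p ^ (k - s)"
          using r(2) by linarith
        ultimately show ?thesis by blast
      qed
    qed
  qed
  then show ?case by (simp add: C_def)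
qed

lemma max_orbits_bound:
  assumes X: "X = orbit (A\<lparr>carrier := H\<rparr>) (path_action (tree_boundary p)) \<xi>"
    and \<xi>: "\<xi> \<in> tree_boundary p"
  shows "max_orbits (p ^ m) (A\<lparr>carrier := H\<rparr>) X (path_action X)
    \<le> enat ((p ^ (k + 1) - 1) * m + p ^ k)"
  unfolding max_orbits_def
proof (rule SUP_least)
  fix U
  assume U_in: "U \<in> {U. subgroup U (A\<lparr>carrier := H\<rparr>) \<and> finite (rcosets\<^bsub>A\<lparr>carrier := H\<rparr>\<^esub> U) \<and>
    card (rcosets\<^bsub>A\<lparr>carrier := H\<rparr>\<^esub> U) \<le> p ^ m}"
  then have U: "subgroup U A" "U \<subseteq> H"
    using incl_subgroup[OF H] subgroup.subset[of U "A\<lparr>carrier := H\<rparr>"] by auto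
  have fin: "finite ((\<lambda>x. U #> x) ` N)" and le: "rel_index U \<le> p ^ m"
    using U_in rel_index_le[of U] by auto
  have p1: "real p > 1" using p_ge_2 by simp
  have "L 0 \<subseteq> U <#> N" using set_multI[OF subgroup.one_closed[OF U(1)]] NA by (fastforce simp: L_0)
  from orbits_bound[OF U fin _ this \<xi>]
  obtain r where r: "orbits_le p H U \<xi> r"
    "real r \<le> (real p ^ (k + 1) - 1) * log p (rel_index U) + real p ^ k" by auto
  have "log p (rel_index U) \<le> log p (real p ^ m)"
    using le rel_index_pos[OF fin] p1 by (intro log_mono) (auto simp flip: of_nat_power)
  then have log_le: "log p (rel_index U) \<le> m" using p1 by (simp add: log_nat_power)
  have "0 \<le> real p ^ (k + 1) - 1" using one_le_power[of "real p" "k + 1"] p1 by linarith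
  from mult_left_mono[OF log_le this] r(2)
  have "real r \<le> (real p ^ (k + 1) - 1) * real m + real p ^ k" by linarith
  also have "\<dots> = real ((p ^ (k + 1) - 1) * m + p ^ k)"
    using one_le_power[of p "k + 1"] p_ge_2 by (simp add: of_nat_diff)
  finally have r_le: "r \<le> (p ^ (k + 1) - 1) * m + p ^ k" by linarith
  have "X = {g \<circ> \<xi> | g. g \<in> H}" using \<xi> by (simp add: X orbit_def path_action_def comp_def)
  from card_orbits_le[OF H U \<xi> this r(1)] r_le
  have "finite (orbits (A\<lparr>carrier := U\<rparr>) X (path_action X))"
    "card (orbits (A\<lparr>carrier := U\<rparr>) X (path_action X)) \<le> (p ^ (k + 1) - 1) * m + p ^ k" by auto
  then show "ecard (orbits (A\<lparr>carrier := H\<rparr>\<lparr>carrier := U\<rparr>) X (path_action X))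
      \<le> enat ((p ^ (k + 1) - 1) * m + p ^ k)"
    by (simp add: ecard_def)
qed

end

section \<open>The Grigorchuk group\<close>

context regular_tree
begin

lemma sect_tuple_aut:
  assumes "length \<phi>s = p" "\<And>i. i < p \<Longrightarrow> \<phi>s ! i \<in> carrier A" "i < p"
  shows "root_perm (tuple_aut \<phi>s) i = i" and "sect p (tuple_aut \<phi>s) i = \<phi>s ! i"
proof -
  have "tuple_aut \<phi>s = tuple p (\<lambda>i. \<phi>s ! i)"
    using map_nth[of \<phi>s] assms(1) by (simp add: tuple_def)
  then show "root_perm (tuple_aut \<phi>s) i = i" "sect p (tuple_aut \<phi>s) i = \<phi>s ! i"
    using root_perm_tuple[of "\<lambda>i. \<phi>s ! i"] sect_tuple[of "\<lambda>i. \<phi>s ! i"] assms by auto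
qed

end

locale grigorchuk = regular_tree 2 A for A (structure)
begin

lemma gens_closed [simp]:
  "grig_a \<in> carrier A" "grig_b \<in> carrier A" "grig_c \<in> carrier A" "grig_d \<in> carrier A"
  by (simp_all add: carrier_A grig_in_tree_auts)

lemma
  assumes "i < 2"
  shows sect_b: "root_perm grig_b i = i \<and> sect 2 grig_b i = [grig_a, grig_c] ! i"
    and sect_c: "root_perm grig_c i = i \<and> sect 2 grig_c i = [grig_a, grig_d] ! i"
    and sect_d: "root_perm grig_d i = i \<and> sect 2 grig_d i = [\<one>, grig_b] ! i"
proof -
  have *: "[grig_a, grig_c] ! i \<in> carrier A" "[grig_a, grig_d] ! i \<in> carrier A"
    "[\<one>, grig_b] ! i \<in> carrier A" if "i < 2" for i
    using that by (auto simp: less_2_cases_iff)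
  note rec = grig_recursion[folded A_def]
  show "root_perm grig_b i = i \<and> sect 2 grig_b i = [grig_a, grig_c] ! i"
    using sect_tuple_aut[of "[grig_a, grig_c]" i, folded rec(1)] *(1) assms by simp
  show "root_perm grig_c i = i \<and> sect 2 grig_c i = [grig_a, grig_d] ! i"
    using sect_tuple_aut[of "[grig_a, grig_d]" i, folded rec(2)] *(2) assms by simp
  show "root_perm grig_d i = i \<and> sect 2 grig_d i = [\<one>, grig_b] ! i"
    using sect_tuple_aut[of "[\<one>, grig_b]" i, folded rec(3)] *(3) assms by simp
qed

lemma root_perm_gens [simp]:
  "root_perm grig_a 0 = Suc 0" "root_perm grig_a (Suc 0) = 0"
  "i < 2 \<Longrightarrow> root_perm grig_b i = i" "i < 2 \<Longrightarrow> root_perm grig_c i = i"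
  "i < 2 \<Longrightarrow> root_perm grig_d i = i"
  using sect_b[of i] sect_c[of i] sect_d[of i] by (simp_all add: grig_a_def root_perm_rotation)

lemma sect_gens [simp]:
  "i < 2 \<Longrightarrow> sect 2 grig_a i = \<one>"
  "sect 2 grig_b 0 = grig_a" "sect 2 grig_b (Suc 0) = grig_c"
  "sect 2 grig_c 0 = grig_a" "sect 2 grig_c (Suc 0) = grig_d"
  "sect 2 grig_d 0 = \<one>" "sect 2 grig_d (Suc 0) = grig_b"
  using sect_b[of 0] sect_b[of 1] sect_c[of 0] sect_c[of 1] sect_d[of 0] sect_d[of 1]
  by (simp_all add: grig_a_def sect_rotation)

lemma grig_a_square [simp]: "grig_a \<otimes> grig_a = \<one>"
  by (rule aut_eqI) (auto simp: less_2_cases_iff)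

text \<open>The six relations have to be proved simultaneously, since the sections of \<open>b\<close>, \<open>c\<close>, \<open>d\<close> at the
  vertex \<open>1\<close> are \<open>c\<close>, \<open>d\<close>, \<open>b\<close>.\<close>

lemma relations_on_words:
  "w \<in> tree_vertices 2 \<Longrightarrow>
    (grig_b \<otimes> grig_b) w = w \<and> (grig_c \<otimes> grig_c) w = w \<and> (grig_d \<otimes> grig_d) w = w \<and>
    (grig_b \<otimes> grig_c) w = grig_d w \<and> (grig_c \<otimes> grig_d) w = grig_b w \<and> (grig_d \<otimes> grig_b) w = grig_c w"
proof (induction w)
  case (Cons i v)
  then have i: "i = 0 \<or> i = Suc 0" and v: "v \<in> tree_vertices 2" by auto
  from i v Cons.IH[OF v] show ?case
    by (elim disjE) (simp_all add: apply_Cons[where i = 0] apply_Cons[where i = "Suc 0"] del: mult_apply)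
qed simp

lemma relations [simp]:
  "grig_b \<otimes> grig_b = \<one>" "grig_c \<otimes> grig_c = \<one>" "grig_d \<otimes> grig_d = \<one>"
  "grig_b \<otimes> grig_c = grig_d" "grig_c \<otimes> grig_d = grig_b" "grig_d \<otimes> grig_b = grig_c"
  by (rule ext_A; use relations_on_words in \<open>simp del: mult_apply\<close>)+

lemma inv_gens [simp]:
  "inv grig_a = grig_a" "inv grig_b = grig_b" "inv grig_c = grig_c" "inv grig_d = grig_d"
  by (rule inv_equality; simp)+

lemma products [simp]:
  "grig_c \<otimes> grig_b = grig_d" "grig_d \<otimes> grig_c = grig_b" "grig_b \<otimes> grig_d = grig_c"
  using arg_cong[OF relations(4), of "m_inv A"] arg_cong[OF relations(5), of "m_inv A"]
    arg_cong[OF relations(6), of "m_inv A"] by (simp_all add: inv_mult_group del: relations)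

abbreviation H :: "tree_map set" where
  "H \<equiv> generate A {grig_a, grig_b, grig_c, grig_d}"

lemma H_sub: "subgroup H A"
  by (rule generate_is_subgroup) simp

lemmas H_m_closed = subgroup.m_closed[OF H_sub] and H_inv_closed = subgroup.m_inv_closed[OF H_sub]

lemma gens_in_H: "grig_a \<in> H" "grig_b \<in> H" "grig_c \<in> H" "grig_d \<in> H"
  by (auto intro: generate.incl)

lemma H_onto: "H \<subseteq> sect_group H 0"
proof (rule generate_subgroup_incl)
  have "grig_a \<in> sect_group H 0"
    by (rule sect_groupI[of grig_b]) (simp_all add: gens_in_H)
  moreover have "grig_c \<in> sect_group H 0"
    by (rule sect_groupI[of "grig_a \<otimes> grig_b \<otimes> grig_a"]) (simp_all add: gens_in_H H_m_closed)
  moreover have "grig_d \<in> sect_group H 0"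
    by (rule sect_groupI[of "grig_a \<otimes> grig_c \<otimes> grig_a"]) (simp_all add: gens_in_H H_m_closed)
  moreover have "grig_b \<in> sect_group H 0"
    by (rule sect_groupI[of "grig_a \<otimes> grig_d \<otimes> grig_a"]) (simp_all add: gens_in_H H_m_closed)
  ultimately show "{grig_a, grig_b, grig_c, grig_d} \<subseteq> sect_group H 0" by blast
qed (simp add: subgroup_sect_group H_sub)

lemma H_sect: "\<lbrakk>f \<in> H; i < 2\<rbrakk> \<Longrightarrow> sect 2 f i \<in> H"
  by (rule sect_generate) (auto simp: less_2_cases_iff gens_in_H generate.one)

text \<open>The generators are involutions, so this is the normal closure of \<open>(ab)^2\<close>, the usual subgroup over
  which the Grigorchuk group branches.\<close>

definition K :: "tree_map set" where
  "K = normal_closure A H {grig_a \<otimes> grig_b \<otimes> inv grig_a \<otimes> inv grig_b}"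

lemma K_normal: "normal_in A H K" and abab_in_K: "grig_a \<otimes> grig_b \<otimes> grig_a \<otimes> grig_b \<in> K"
proof -
  have S: "{grig_a \<otimes> grig_b \<otimes> inv grig_a \<otimes> inv grig_b} \<subseteq> H"
    by (simp add: gens_in_H H_m_closed)
  show "normal_in A H K" unfolding K_def by (rule normal_in_normal_closure[OF H_sub S])
  show "grig_a \<otimes> grig_b \<otimes> grig_a \<otimes> grig_b \<in> K"
    using normal_closure_incl[OF H_sub S] by (simp add: K_def)
qed

text \<open>As \<open>b\<close> commutes modulo \<open>K\<close> with \<open>a\<close> and \<open>d\<close>, the commutator of \<open>ada = (b, 1)\<close> and \<open>b = (a, c)\<close> lies in \<open>K\<close>;
  it equals \<open>([b, a], 1)\<close>, and \<open>[b, a]\<close> generates \<open>K\<close> as a normal subgroup.\<close>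

lemma K_branch: "n \<in> K \<Longrightarrow> inject n \<in> K"
proof -
  let ?x = "grig_a \<otimes> grig_d \<otimes> grig_a"
  let ?Z = "{x \<in> H. x \<otimes> grig_b \<otimes> inv x \<otimes> inv grig_b \<in> K}"
  have Ksub: "subgroup K A" using K_normal by (simp add: normal_in_def)
  have Z: "subgroup ?Z A" by (rule subgroup_centralizer_mod[OF H_sub K_normal gens_in_H(2)])
  have "grig_a \<in> ?Z" using abab_in_K gens_in_H by simp
  moreover have "grig_d \<in> ?Z" using gens_in_H subgroup.one_closed[OF Ksub] by (simp add: m_assoc)
  ultimately have "?x \<in> ?Z" using subgroup.m_closed[OF Z] by blast
  then have "?x \<otimes> grig_b \<otimes> inv ?x \<otimes> inv grig_b \<in> K" by blast
  also have "?x \<otimes> grig_b \<otimes> inv ?x \<otimes> inv grig_b = inject (grig_b \<otimes> grig_a \<otimes> grig_b \<otimes> grig_a)"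
    by (subst commutator_eq_inject) (auto simp: less_2_cases_iff)
  finally have "grig_b \<otimes> grig_a \<otimes> grig_b \<otimes> grig_a \<in> {n \<in> H. inject n \<in> K}" (is "?t \<in> ?D")
    by (simp add: gens_in_H H_m_closed)
  moreover have D: "normal_in A H ?D" by (rule normal_in_inject[OF H_sub K_normal H_onto]) simp
  ultimately have "inv ?t \<in> ?D" using subgroup.m_inv_closed[of ?D A] by (simp only: normal_in_def)
  then have t: "grig_a \<otimes> grig_b \<otimes> inv grig_a \<otimes> inv grig_b \<in> ?D"
    by (simp add: inv_mult_group m_assoc)
  have "K \<subseteq> ?D"
    by (subst K_def, rule normal_closure_minimal) (use D t in \<open>auto simp: normal_in_def\<close>)
  then show "n \<in> K \<Longrightarrow> inject n \<in> K" by blast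
qed

text \<open>The sections at \<open>0\<close> of \<open>K\<close> contain \<open>ca\<close>, as \<open>abab = (ca, ac)\<close>. Those of the normal closure of \<open>ca\<close>
  contain \<open>ad\<close> and \<open>b\<close>, as \<open>(ca)^2 = (ad, da)\<close> and \<open>ac (ac)^b = (ad)^2 = (b, b)\<close>. Those of the normal
  closure of \<open>ad\<close> and \<open>b\<close> contain \<open>a\<close>, \<open>b\<close> and \<open>c\<close>, as \<open>b = (a, c)\<close>, \<open>aba = (c, a)\<close> and \<open>(ad)^2 = (b, b)\<close>.\<close>

definition chain :: "nat \<Rightarrow> tree_map set" where
  "chain s = (if s = 0 then K
    else if s = 1 then normal_closure A H {grig_c \<otimes> grig_a}
    else if s = 2 then normal_closure A H {grig_a \<otimes> grig_d, grig_b}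
    else H)"

lemma chain_normal: "normal_in A H (chain s)"
  unfolding chain_def using K_normal normal_in_self[OF H_sub]
  by (auto intro!: normal_in_normal_closure[OF H_sub] simp: gens_in_H H_m_closed)

lemma chain_sub: "subgroup (chain s) A"
  using chain_normal[of s] by (simp add: normal_in_def)

lemma chain_step:
  assumes "s < 3"
  shows "chain (Suc s) \<subseteq> sect_group (chain s) 0"
proof -
  have sub: "subgroup (sect_group (chain s) 0) A" for s
    by (rule subgroup_sect_group[OF chain_sub]) simp
  have incl: "normal_closure A H S \<subseteq> sect_group (chain s) 0" if "S \<subseteq> sect_group (chain s) 0" for S s
    by (rule normal_closure_subset_sect_group[OF H_sub H_onto _ chain_normal that]) simp
  consider "s = 0" | "s = 1" | "s = 2" using assms by linarith
  then show ?thesis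
  proof cases
    case 1
    have "grig_c \<otimes> grig_a \<in> sect_group (chain 0) 0"
      by (rule sect_groupI[of "grig_a \<otimes> grig_b \<otimes> grig_a \<otimes> grig_b"])
        (use abab_in_K in \<open>simp_all add: chain_def\<close>)
    then have "{grig_c \<otimes> grig_a} \<subseteq> sect_group (chain 0) 0" by simp
    from incl[OF this] show ?thesis using 1 by (simp add: chain_def)
  next
    case 2
    have ca: "grig_c \<otimes> grig_a \<in> chain 1"
      using normal_closure_incl[OF H_sub, of "{grig_c \<otimes> grig_a}"]
      by (simp add: chain_def gens_in_H H_m_closed)
    have "grig_a \<otimes> grig_d \<in> sect_group (chain 1) 0"
      by (rule sect_groupI[OF subgroup.m_closed[OF chain_sub ca ca]]) simp_all
    moreover have "grig_b \<in> sect_group (chain 1) 0"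
      by (rule sect_groupI[OF subgroup.m_closed[OF chain_sub subgroup.m_inv_closed[OF chain_sub ca]
            normal_in_conj[OF chain_normal gens_in_H(2) subgroup.m_inv_closed[OF chain_sub ca]]]])
        (simp_all add: inv_mult_group m_assoc)
    ultimately have "{grig_a \<otimes> grig_d, grig_b} \<subseteq> sect_group (chain 1) 0" by simp
    from incl[OF this] show ?thesis using 2 by (simp add: chain_def numeral_2_eq_2)
  next
    case 3
    have "{grig_a \<otimes> grig_d, grig_b} \<subseteq> chain 2"
      using normal_closure_incl[OF H_sub, of "{grig_a \<otimes> grig_d, grig_b}"]
      by (simp add: chain_def gens_in_H H_m_closed)
    then have ad: "grig_a \<otimes> grig_d \<in> chain 2" and b: "grig_b \<in> chain 2" by simp_all
    have a': "grig_a \<in> sect_group (chain 2) 0" by (rule sect_groupI[OF b]) simp_all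
    have c': "grig_c \<in> sect_group (chain 2) 0"
      by (rule sect_groupI[OF normal_in_conj[OF chain_normal gens_in_H(1) b]]) simp_all
    have b': "grig_b \<in> sect_group (chain 2) 0"
      by (rule sect_groupI[OF subgroup.m_closed[OF chain_sub ad ad]]) simp_all
    have "grig_d \<in> sect_group (chain 2) 0" using subgroup.m_closed[OF sub b' c'] by simp
    then have "H \<subseteq> sect_group (chain 2) 0"
      using a' b' c' by (intro generate_subgroup_incl[OF _ sub]) blast
    then show ?thesis using 3 by (simp add: chain_def)
  qed
qed

lemma branching: "branching_group 2 A H K chain 3"
proof (intro branching_group.intro branching_group_axioms.intro regular_tree_axioms
    H_sub H_sect K_normal K_branch chain_normal chain_step)
  show "\<exists>e :: nat. x [^] (d * e) \<otimes> inv x \<in> tuples K" if "x \<in> K" "0 < d" "d < 2" for x d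
  proof -
    have Ksub: "subgroup K A" using K_normal by (simp add: normal_in_def)
    have "x [^] (d * 1) \<otimes> inv x = \<one>" using that subgroup.mem_carrier[OF Ksub] by (simp add: less_2_cases_iff)
    then show ?thesis using subgroup.one_closed[OF subgroup_tuples[OF Ksub]] by metis
  qed
  show "rotation 2 \<in> H" using gens_in_H(1) by (simp add: grig_a_def)
qed (simp_all add: chain_def)

end

section \<open>The Gupta--Sidki groups\<close>

locale gupta_sidki = regular_tree p A for p and A (structure) +
  assumes prime: "prime p" and p_ge_3: "3 \<le> p"
begin

abbreviation a :: tree_map where "a \<equiv> gs_a p"
abbreviation b :: tree_map where "b \<equiv> gs_b p"

lemma gens_closed [simp]: "a \<in> carrier A" "b \<in> carrier A"
  using p_ge_3 by (simp_all add: carrier_A gs_in_tree_auts)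

lemma root_perm_a: "i < p \<Longrightarrow> root_perm a i = (i + 1) mod p"
  and sect_a [simp]: "i < p \<Longrightarrow> sect p a i = \<one>"
  by (simp_all add: gs_a_def root_perm_rotation sect_rotation)

lemma
  assumes i: "i < p"
  shows root_perm_b [simp]: "root_perm b i = i"
    and sect_b: "sect p b i = (if i = 0 then a else if i = 1 then inv a else if i = p - 1 then b else \<one>)"
      (is "_ = ?s i")
proof -
  have word: "b (i # v) = i # ?s i v" if "v \<in> tree_vertices p" for v
    using i that by (simp add: gs_b_def A_def[symmetric])
  show "root_perm b i = i" using word[of "[]"] by (simp add: root_perm_def)
  have s: "?s i \<in> carrier A" by simp
  show "sect p b i = ?s i"
    by (rule ext_A[OF sect_closed[OF _ i] s]) (simp_all add: word sect_def del: gens_closed, simp)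
qed

lemma sect_b_simps [simp]:
  "sect p b 0 = a" "sect p b (Suc 0) = inv a" "sect p b (p - Suc 0) = b"
proof -
  have "0 < p" "Suc 0 < p" "p - Suc 0 \<noteq> 0" "p - Suc 0 \<noteq> Suc 0" "p - Suc 0 < p"
    using p_ge_3 by linarith+
  then show "sect p b 0 = a" "sect p b (Suc 0) = inv a" "sect p b (p - Suc 0) = b"
    by (simp_all add: sect_b)
qed

lemma a_pow: "i < p \<Longrightarrow> root_perm (a [^] n) i = (i + n) mod p \<and> sect p (a [^] (n :: nat)) i = \<one>"
proof (induction n arbitrary: i)
  case (Suc n)
  then have "(i + 1) mod p < p" by simp
  with Suc show ?case by (simp add: root_perm_a mod_simps)
qed simp

lemma a_order: "a [^] p = \<one>"
  by (rule aut_eqI) (simp_all add: a_pow)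

lemma b_pow: "i < p \<Longrightarrow> root_perm (b [^] n) i = i \<and> sect p (b [^] (n :: nat)) i = sect p b i [^] n"
  by (induction n) simp_all

lemma b_order: "b [^] p = \<one>"
proof (rule ext_A)
  fix w assume "w \<in> tree_vertices p"
  then show "(b [^] p) w = \<one> w"
  proof (induction w)
    case (Cons i v)
    then have iv: "i < p" "v \<in> tree_vertices p" by auto
    have "(sect p b i [^] p) v = v"
      using Cons.IH[OF iv(2)] iv by (simp add: sect_b a_order nat_pow_inv)
    then show ?case using iv apply_Cons[of "b [^] p" i v] b_pow[of i p] by simp
  qed simp
qed simp_all

abbreviation H :: "tree_map set" where "H \<equiv> generate A {a, b}"

lemma H_sub: "subgroup H A"
  by (rule generate_is_subgroup) simp

lemmas H_m_closed = subgroup.m_closed[OF H_sub] and H_inv_closed = subgroup.m_inv_closed[OF H_sub]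

lemma HA: "f \<in> H \<Longrightarrow> f \<in> carrier A" by (rule subgroup.mem_carrier[OF H_sub])

lemma gens_in_H: "a \<in> H" "b \<in> H"
  by (auto intro: generate.incl)

lemma H_sect: "\<lbrakk>f \<in> H; i < p\<rbrakk> \<Longrightarrow> sect p f i \<in> H"
  by (rule sect_generate) (auto simp: sect_b gens_in_H H_inv_closed generate.one)

text \<open>As the two generators commute modulo \<open>N\<close>, this is the derived subgroup of \<open>H\<close>.\<close>

definition N :: "tree_map set" where
  "N = normal_closure A H {a \<otimes> b \<otimes> inv a \<otimes> inv b}"

lemma N_normal: "normal_in A H N" and comm_in_N: "a \<otimes> b \<otimes> inv a \<otimes> inv b \<in> N"
proof -
  have S: "{a \<otimes> b \<otimes> inv a \<otimes> inv b} \<subseteq> H"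
    by (simp add: gens_in_H H_m_closed H_inv_closed)
  show "normal_in A H N" unfolding N_def by (rule normal_in_normal_closure[OF H_sub S])
  show "a \<otimes> b \<otimes> inv a \<otimes> inv b \<in> N"
    using normal_closure_incl[OF H_sub S] by (simp add: N_def)
qed

lemma N_sub: "subgroup N A" and NH: "N \<subseteq> H" using N_normal by (simp_all add: normal_in_def)

lemma commutators_in_N:
  assumes "x \<in> H" "y \<in> H" shows "x \<otimes> y \<otimes> inv x \<otimes> inv y \<in> N"
proof (rule commutators_in_normal[OF H_sub N_normal order_refl _ _ assms])
  have "inv (a \<otimes> b \<otimes> inv a \<otimes> inv b) \<in> N" by (rule subgroup.m_inv_closed[OF N_sub comm_in_N])
  then have ba: "b \<otimes> a \<otimes> inv b \<otimes> inv a \<in> N" by (simp add: inv_mult_group m_assoc)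
  show "s \<otimes> t \<otimes> inv s \<otimes> inv t \<in> N" if "s \<in> {a, b}" "t \<in> {a, b}" for s t
    using that comm_in_N ba subgroup.one_closed[OF N_sub] by (auto simp: m_assoc)
qed (use gens_in_H in simp)

lemma N_fixes_level_1: "\<lbrakk>x \<in> N; i < p\<rbrakk> \<Longrightarrow> root_perm x i = i"
proof -
  let ?S = "{x \<in> carrier A. \<forall>i<p. root_perm x i = i}"
  have "N \<subseteq> ?S"
    unfolding N_def
  proof (rule normal_closure_minimal)
    show "subgroup ?S A"
    proof (rule subgroupI)
      have "\<one> \<in> ?S" by simp
      then show "?S \<noteq> {}" by blast
      show "inv x \<in> ?S" if "x \<in> ?S" for x using that root_perm_inv[of x] by simp
    qed auto
    have "root_perm (inv b) i = i" if "i < p" for i using that root_perm_inv[of b i i] by simp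
    then show "{a \<otimes> b \<otimes> inv a \<otimes> inv b} \<subseteq> ?S" by simp
    show "h \<otimes> n \<otimes> inv h \<in> ?S" if "h \<in> H" "n \<in> ?S" for h n
      using that HA by simp
  qed
  then show "\<lbrakk>x \<in> N; i < p\<rbrakk> \<Longrightarrow> root_perm x i = i" by blast
qed

text \<open>\<open>H / N\<close> is abelian and generated by two elements whose \<open>p\<close>-th powers are trivial.\<close>

lemma pow_in_N: "h \<in> H \<Longrightarrow> h [^] p \<in> N"
proof -
  have "H \<subseteq> {h \<in> H. h [^] p \<in> N}"
    by (rule generate_subgroup_incl[OF _ subgroup_powers_in[OF H_sub N_normal commutators_in_N]])
      (use gens_in_H a_order b_order subgroup.one_closed[OF N_sub] in auto)
  then show "h \<in> H \<Longrightarrow> h [^] p \<in> N" by blast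
qed

text \<open>The \<open>p\<close>-th power of \<open>x \<in> N\<close> is taken in each coordinate separately, so it lies in \<open>N \<times> \<dots> \<times> N\<close>;
  hence \<open>e\<close> can be chosen as an inverse of \<open>d\<close> modulo \<open>p\<close>.\<close>

lemma N_power:
  assumes x: "x \<in> N" and d: "0 < d" "d < p"
  shows "\<exists>e :: nat. x [^] (d * e) \<otimes> inv x \<in> tuples N"
proof -
  have xH: "x \<in> H" and xA: "x \<in> carrier A" using x NH HA by auto
  have "\<not> p dvd d" using d by (auto dest: dvd_imp_le)
  then have "coprime d p" using prime prime_imp_coprime coprime_commute by blast
  then obtain e q where eq: "d * e = p * q + 1" using bezout_nat[of d p] d by auto
  have pow: "root_perm (x [^] n) i = i \<and> sect p (x [^] n) i = sect p x i [^] n"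
    if "i < p" for i and n :: nat
    using that xA N_fixes_level_1[OF x] by (induction n) simp_all
  have xp: "x [^] p \<in> tuples N"
    using xA pow pow_in_N[OF H_sect[OF xH]] by (simp add: tuples_def)
  have sub: "subgroup (tuples N) A" by (rule subgroup_tuples[OF N_sub])
  have "(x [^] p) [^] n \<in> tuples N" for n :: nat
    by (induction n) (use subgroup.one_closed[OF sub] subgroup.m_closed[OF sub] xp in auto)
  moreover have "x [^] (d * e) \<otimes> inv x = (x [^] p) [^] q"
    using xA by (simp add: eq nat_pow_pow m_assoc)
  ultimately show ?thesis by metis
qed

text \<open>The first two coordinates of \<open>[a, b] = (b a^-1, a^2, \<dots>)\<close> are moved to the vertex \<open>0\<close> by conjugation
  with \<open>a\<close>. As \<open>a\<close> has odd order, it is a power of \<open>a^2\<close>, so both coordinates together generate \<open>H\<close>.\<close>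

lemma N_onto: "H \<subseteq> sect_group N 0"
proof -
  let ?P = "sect_group N 0" and ?c = "a \<otimes> b \<otimes> inv a \<otimes> inv b"
  have p: "0 < p" "Suc 0 < p" "p - Suc 0 < p" using p_ge_3 by auto
  have P: "subgroup ?P A" by (rule subgroup_sect_group[OF N_sub p(1)])
  have ra: "root_perm a 0 = Suc 0" "root_perm a (p - Suc 0) = 0"
    using p_ge_3 by (simp_all add: root_perm_a)
  have ia: "root_perm (inv a) (Suc 0) = 0" "root_perm (inv a) 0 = p - Suc 0"
    using root_perm_inv[of a 0] root_perm_inv[of a "p - Suc 0"] ra p by auto
  have sia: "sect p (inv a) i = \<one>" if "i < p" for i
    using sect_inv[of a "root_perm (inv a) i" i] that by simp
  have ib: "root_perm (inv b) i = i" "sect p (inv b) i = inv (sect p b i)" if "i < p" for i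
    using root_perm_inv[of b i i] sect_inv[of b i i] that by simp_all
  have c0: "sect p ?c 0 = b \<otimes> inv a"
    using p ia sia ib ra by simp
  have c1: "root_perm ?c (Suc 0) = Suc 0" "sect p ?c (Suc 0) = a \<otimes> a"
    using p ia sia ib ra by simp_all
  have ba: "b \<otimes> inv a \<in> ?P"
    by (rule sect_groupI[OF comm_in_N N_fixes_level_1[OF comm_in_N p(1)] c0])
  have conj: "inv a \<otimes> ?c \<otimes> a \<in> N"
    by (rule normal_in_conj'[OF H_sub N_normal gens_in_H(1) comm_in_N])
  have "sect p (inv a \<otimes> ?c \<otimes> a) 0 = sect p ?c (Suc 0)"
    using p ra sia c1(1) by (simp del: sect_mult root_perm_mult add: sect_mult[of "inv a \<otimes> ?c" a]
        sect_mult[of "inv a" ?c] root_perm_mult[of "inv a" ?c])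
  then have aa: "a \<otimes> a \<in> ?P"
    by (intro sect_groupI[OF conj N_fixes_level_1[OF conj p(1)]]) (simp only: c1)
  have "odd p" using prime p_ge_3 prime_odd_nat by force
  then obtain q where q: "p = 2 * q + 1" by (rule oddE)
  have "(a \<otimes> a) [^] n = a [^] (2 * n)" "(a \<otimes> a) [^] n \<in> ?P" for n :: nat
    by (induction n) (use subgroup.one_closed[OF P] subgroup.m_closed[OF P _ aa] in \<open>simp_all add: m_assoc\<close>)
  then have "a [^] (2 * (q + 1)) \<in> ?P" by metis
  also have "a [^] (2 * (q + 1)) = a [^] p \<otimes> a" by (simp add: q)
  finally have a: "a \<in> ?P" by (simp add: a_order)
  moreover have "b \<in> ?P" using subgroup.m_closed[OF P ba a] by (simp add: m_assoc)
  ultimately show ?thesis by (intro generate_subgroup_incl[OF _ P]) simp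
qed

lemma H_onto: "H \<subseteq> sect_group H 0"
  using N_onto NH by (auto simp: sect_group_def)

text \<open>For \<open>p \<ge> 5\<close> the conjugates \<open>b = (a, a^-1, 1, \<dots>, 1, b)\<close> and \<open>b' = (b, a, a^-1, 1, \<dots>, 1)\<close> commute in all
  coordinates but the first, so \<open>[b, b'] = ([a, b], 1, \<dots>, 1)\<close>. For \<open>p = 3\<close> the last coordinates \<open>b\<close> and
  \<open>a^-1\<close> interfere. With the third conjugate \<open>b'' = (a^-1, b, a)\<close> the products \<open>b b' = (ab, 1, b a^-1)\<close> and
  \<open>b' b'' = (b a^-1, ab, 1)\<close> commute in all coordinates but the first, where \<open>ab\<close> and \<open>b a^-1\<close> appear,
  and these two elements generate \<open>H\<close> because \<open>b\<close> has odd order.\<close>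

lemma N_branch: "n \<in> N \<Longrightarrow> inject n \<in> N"
proof -
  let ?D = "{n \<in> H. inject n \<in> N}"
  have p: "0 < p" "Suc 0 < p" "p - Suc 0 < p" using p_ge_3 by auto
  have D: "normal_in A H ?D" by (rule normal_in_inject[OF H_sub N_normal H_onto p(1)])
  have Dsub: "subgroup ?D A" using D by (simp add: normal_in_def)
  define b' where "b' = a \<otimes> b \<otimes> inv a"
  have b'H: "b' \<in> H" by (simp add: b'_def gens_in_H H_m_closed H_inv_closed)
  note b'A = HA[OF b'H]
  have ra: "root_perm (inv a) i = (if i = 0 then p - 1 else i - 1)" if "i < p" for i
    using root_perm_inv[of a "p - 1" i] root_perm_inv[of a "i - 1" i] that p
    by (cases "i = 0") (simp_all add: root_perm_a)
  have sia: "sect p (inv a) i = \<one>" if "i < p" for i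
    using sect_inv[of a "root_perm (inv a) i" i] that by simp
  have b': "root_perm b' i = i" "sect p b' i = sect p b (if i = 0 then p - 1 else i - 1)"
    if i: "i < p" for i
    using ra[OF i] sia[OF i] i by (simp_all add: b'_def root_perm_a)
  \<comment> \<open>Commutators of elements of \<open>H\<close> lie in \<open>N\<close>; those concentrated in the first coordinate put it into \<open>?D\<close>.\<close>
  have in_D: "sect p x 0 \<otimes> sect p y 0 \<otimes> inv (sect p x 0) \<otimes> inv (sect p y 0) \<in> ?D"
    if x: "x \<in> H" "\<And>i. i < p \<Longrightarrow> root_perm x i = i" and y: "y \<in> H" "\<And>i. i < p \<Longrightarrow> root_perm y i = i"
      and comm: "\<And>i. \<lbrakk>0 < i; i < p\<rbrakk> \<Longrightarrow> sect p x i \<otimes> sect p y i = sect p y i \<otimes> sect p x i" for x y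
    using commutator_eq_inject[OF HA[OF x(1)] HA[OF y(1)] p(1) x(2) y(2) comm]
      commutators_in_N[OF x(1) y(1)] H_sect[OF x(1) p(1)] H_sect[OF y(1) p(1)] H_m_closed H_inv_closed
    by simp
  have "a \<otimes> b \<otimes> inv a \<otimes> inv b \<in> ?D"
  proof (cases "p = 3")
    case False
    then have "5 \<le> p" using p_ge_3 prime by (cases "p = 4") (auto simp: prime_nat_iff dest!: spec[of _ 2])
    have "sect p b i \<otimes> sect p b' i = sect p b' i \<otimes> sect p b i" if "0 < i" "i < p" for i
      using that \<open>5 \<le> p\<close> by (simp add: b' sect_b)
    from in_D[OF gens_in_H(2) _ b'H _ this] show ?thesis using p b' by simp
  next
    case True
    define b'' where "b'' = a \<otimes> b' \<otimes> inv a"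
    have b''H: "b'' \<in> H" by (simp add: b''_def gens_in_H H_m_closed H_inv_closed b'H)
    note b''A = HA[OF b''H]
    have b'': "root_perm b'' i = i" "sect p b'' i = sect p b' (if i = 0 then p - 1 else i - 1)"
      if i: "i < p" for i
      using ra[OF i] sia[OF i] b'(1) i b'A by (simp_all add: b''_def root_perm_a)
    have s: "sect p b 2 = b" "sect p b' 0 = b" "sect p b' (Suc 0) = a" "sect p b' 2 = inv a"
      "sect p b'' 0 = inv a" "sect p b'' (Suc 0) = b" "sect p b'' 2 = a"
    proof -
      have *: "2 < p" "p - Suc 0 = 2" using True by simp_all
      have b2: "sect p b 2 = b" using sect_b_simps(3) by (simp only: *)
      note b'_simps = b'(2)[of 0] b'(2)[of 1] b'(2)[of 2]
      show "sect p b 2 = b" "sect p b' 0 = b" "sect p b' (Suc 0) = a" "sect p b' 2 = inv a"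
        using b2 b'_simps p(1,2) * by simp_all
      then show "sect p b'' 0 = inv a" "sect p b'' (Suc 0) = b" "sect p b'' 2 = a"
        using b''(2)[of 0] b''(2)[of 1] b''(2)[of 2] p(1,2) * by simp_all
    qed
    let ?x = "a \<otimes> b" and ?y = "b \<otimes> inv a"
    have "sect p (b \<otimes> b') i \<otimes> sect p (b' \<otimes> b'') i = sect p (b' \<otimes> b'') i \<otimes> sect p (b \<otimes> b') i"
      if "0 < i" "i < p" for i
    proof -
      have "i = Suc 0 \<or> i = 2" using that True by linarith
      then show ?thesis
        using that b'A b''A by (elim disjE) (simp_all add: s b'(1) b''(1))
    qed
    from in_D[OF H_m_closed[OF gens_in_H(2) b'H] _ H_m_closed[OF b'H b''H] _ this]
    have xy: "?x \<otimes> ?y \<otimes> inv ?x \<otimes> inv ?y \<in> ?D" using b'A b''A b'(1) b''(1) s p by simp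
    have xyA: "?x \<in> carrier A" "?y \<in> carrier A" by simp_all
    have yx: "?y \<otimes> ?x \<otimes> inv ?y \<otimes> inv ?x \<in> ?D"
      using subgroup.m_inv_closed[OF Dsub xy] by (simp add: inv_mult_group m_assoc)
    \<comment> \<open>\<open>(b a^-1)(ab) = b^2\<close>, and \<open>b^4 = b\<close>.\<close>
    have gen: "H \<subseteq> generate A {?x, ?y}"
    proof -
      have sub: "subgroup (generate A {?x, ?y}) A" by (rule generate_is_subgroup) simp
      have x: "?x \<in> generate A {?x, ?y}" and y: "?y \<in> generate A {?x, ?y}"
        by (auto intro: generate.incl)
      have bb: "b \<otimes> b \<in> generate A {?x, ?y}" using subgroup.m_closed[OF sub y x] by (simp add: m_assoc)
      have "b [^] (3 :: nat) = \<one>" using b_order by (simp only: True)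
      moreover have "b [^] (3 :: nat) = b \<otimes> (b \<otimes> b)" by (simp add: numeral_3_eq_3 m_assoc)
      ultimately have "b \<otimes> (b \<otimes> b) = \<one>" by metis
      then have "b \<otimes> b \<otimes> (b \<otimes> b) = b" by (simp add: m_assoc)
      then have b: "b \<in> generate A {?x, ?y}" using subgroup.m_closed[OF sub bb bb] by simp
      have "a \<in> generate A {?x, ?y}"
        using subgroup.m_closed[OF sub x subgroup.m_inv_closed[OF sub b]] by (simp add: m_assoc)
      with b show ?thesis by (intro generate_subgroup_incl[OF _ sub]) simp
    qed
    show ?thesis
    proof (rule commutators_in_normal[OF H_sub D gen _ _ gens_in_H])
      show "{?x, ?y} \<subseteq> H" by (simp add: gens_in_H H_m_closed H_inv_closed)
      have one: "z \<otimes> z \<otimes> inv z \<otimes> inv z \<in> ?D" if "z \<in> carrier A" for z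
      proof -
        have "z \<otimes> z \<otimes> inv z \<otimes> inv z = \<one>" using that by (simp add: m_assoc)
        then show ?thesis using subgroup.one_closed[OF Dsub] by (simp only:)
      qed
      show "s \<otimes> t \<otimes> inv s \<otimes> inv t \<in> ?D" if "s \<in> {?x, ?y}" "t \<in> {?x, ?y}" for s t
        using that xy yx one[OF xyA(1)] one[OF xyA(2)] by blast
    qed
  qed
  then have "N \<subseteq> ?D"
    unfolding N_def by (intro normal_closure_minimal[OF Dsub[unfolded N_def]])
      (use D[unfolded N_def] in \<open>auto simp: normal_in_def\<close>)
  then show "n \<in> N \<Longrightarrow> inject n \<in> N" by blast
qed

lemma branching: "branching_group p A H N (\<lambda>s. if s = 0 then N else H) 1"
proof (intro branching_group.intro branching_group_axioms.intro regular_tree_axioms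
    H_sub H_sect N_normal N_branch N_power)
  show "rotation p \<in> H" using gens_in_H by (simp add: gs_a_def)
qed (use p_ge_3 N_normal N_onto normal_in_self[OF H_sub] in \<open>auto split: if_splits\<close>)

end

section \<open>The bound\<close>

lemma bound_arith:
  fixes p m k :: nat
  assumes p: "2 \<le> p" and m: "1 \<le> m" and k: "k \<le> 3"
  shows "(p ^ (k + 1) - 1) * m + p ^ k \<le> (p ^ 5 - 1) * m + 1"
proof -
  have "p ^ (k + 1) \<le> p ^ 4" "p ^ k \<le> p ^ 4"
    using p k power_increasing[of "k + 1" 4 p] power_increasing[of k 4 p] by auto
  then have "(p ^ (k + 1) - 1) * m + p ^ k \<le> (p ^ 4 - 1) * m + p ^ 4 * m"
    using m by (intro add_mono mult_le_mono) (auto intro: order_trans)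
  also have "\<dots> = (p ^ 4 - 1 + p ^ 4) * m" by (simp add: algebra_simps)
  also have "\<dots> \<le> (p ^ 5 - 1) * m"
  proof (rule mult_le_mono1)
    have "2 * p ^ 4 \<le> p * p ^ 4" using p by (rule mult_le_mono1)
    also have "\<dots> = p ^ 5" by (simp add: power_numeral_reduce)
    finally show "p ^ 4 - 1 + p ^ 4 \<le> p ^ 5 - 1" using p by simp
  qed
  finally show ?thesis by simp
qed

theorem theorem8:
  fixes p m :: nat
    and G :: "(nat list \<Rightarrow> nat list) monoid"
    and \<xi> :: "nat \<Rightarrow> nat list"
    and X :: "(nat \<Rightarrow> nat list) set"
  assumes "p = 2 \<and> G = grigorchuk_group \<or> prime p \<and> p \<ge> 3 \<and> G = gupta_sidki_group p"
    and "\<xi> \<in> tree_boundary p"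
    and "X = orbit G (path_action (tree_boundary p)) \<xi>"
    and "m \<ge> 1"
  shows "max_orbits (p ^ m) G X (path_action X) \<le> enat ((p ^ 5 - 1) * m + 1)
    \<and> (p ^ 5 - 1) * m + 1 \<le> p ^ 5 * m"
proof
  obtain A H where A: "A = tree_Aut p" and G: "G = A\<lparr>carrier := H\<rparr>"
    and branching: "\<exists>N L k. k \<le> 3 \<and> branching_group p A H N L k"
    using assms(1)
  proof (elim disjE conjE)
    assume p: "p = 2" and G: "G = grigorchuk_group"
    interpret grigorchuk "tree_Aut 2" by unfold_locales simp
    show thesis by (rule that[OF refl]) (use p G branching in \<open>auto simp: grigorchuk_group_def\<close>)
  next
    assume p: "prime p" "3 \<le> p" and G: "G = gupta_sidki_group p"
    interpret gupta_sidki p "tree_Aut p" by unfold_locales (use p in simp_all)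
    have "\<exists>N L k. k \<le> 3 \<and> branching_group p (tree_Aut p) H N L k"
      using branching by (intro exI conjI) auto
    then show thesis by (intro that[OF refl]) (use G in \<open>simp_all add: gupta_sidki_group_def\<close>)
  qed
  then obtain N L k where k: "k \<le> 3" and bg: "branching_group p A H N L k" by blast
  have p: "2 \<le> p" using branching_group.p_ge_2[OF bg] .
  have "max_orbits (p ^ m) G X (path_action X) \<le> enat ((p ^ (k + 1) - 1) * m + p ^ k)"
    unfolding G
    by (rule branching_group.max_orbits_bound[OF bg _ assms(2)]) (simp add: assms(3) G)
  also have "\<dots> \<le> enat ((p ^ 5 - 1) * m + 1)" using bound_arith[OF p assms(4) k] by simp
  finally show "max_orbits (p ^ m) G X (path_action X) \<le> enat ((p ^ 5 - 1) * m + 1)" .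
  have "(p ^ 5 - 1) * m + 1 \<le> (p ^ 5 - 1) * m + m" using assms(4) by simp
  also have "\<dots> = (p ^ 5 - 1 + 1) * m" by (simp add: algebra_simps)
  also have "\<dots> = p ^ 5 * m" using p by simp
  finally show "(p ^ 5 - 1) * m + 1 \<le> p ^ 5 * m" .
qed

end
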